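(* Let $\mathcal{A}:f=0$ be a free line arrangement in $\mathbb{P}^2_{\mathbb{C}}$, and set $m=m(\mathcal{A})$ and $d=|\mathcal{A}|$. Then $\mathcal{A}$ is supersolvable if and only if $$mdr(f)=\min\{m-1,\,d-m\}.$$ In particular, any line arrangement $\mathcal{A}:f=0$ of $d$ lines in $\mathbb{P}^2_{\mathbb{C}}$ (not assumed free) satisfying $$m(\mathcal{A})=mdr(f)+1\leq\frac{d}{2}$$ is supersolvable.
   Context: Let $S=\mathbb{C}[x,y,z]$ and let $\mathcal{A}:f=0$ be an arrangement of $d=|\mathcal{A}|$ distinct lines in $\mathbb{P}^2_{\mathbb{C}}$, with $f$ the product of the $d$ linear forms. $m(\mathcal{A})$ is the maximal multiplicity of an intersection point of $\mathcal{A}$ (the maximal number of lines of $\mathcal{A}$ through an intersection point). $AR(f)$ is the graded $S$-module of triples $(a,b,c)\in S^3$ with $af_x+bf_y+cf_z=0$, and $mdr(f)$ is the smallest $r\geq 0$ such that $AR(f)_r\neq 0$ (triples of homogeneous polynomials of degree $r$). $\mathcal{A}$ is free if $AR(f)$ is a free graded $S$-module (necessarily of rank 2). An intersection point $p$ of $\mathcal{A}$ is modular if for every other intersection point $p'$ of $\mathcal{A}$ the line $\overline{pp'}$ belongs to $\mathcal{A}$; $\mathcal{A}$ is supersolvable if it has a modular point. *)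

theory Defs
  imports "HOL-Analysis.Analysis" "HOL-Library.Poly_Mapping"
begin

text \<open>
  The ring \<open>S = \<complex>[x,y,z]\<close> is the monoid algebra of the exponent vectors \<open>3 \<Rightarrow>\<^sub>0 nat\<close>;
  the three variables are indexed by the three-element type \<open>3\<close>.
\<close>

type_synonym polyS = "(3 \<Rightarrow>\<^sub>0 nat) \<Rightarrow>\<^sub>0 complex"

definition monomial_degree :: "(3 \<Rightarrow>\<^sub>0 nat) \<Rightarrow> nat"
  where "monomial_degree u = (\<Sum>i\<in>UNIV. Poly_Mapping.lookup u i)"

text \<open>As usual, the zero polynomial is homogeneous of every degree.\<close>

definition homogeneous :: "nat \<Rightarrow> polyS \<Rightarrow> bool"
  where "homogeneous r p \<longleftrightarrow> (\<forall>u\<in>Poly_Mapping.keys p. monomial_degree u = r)"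

text \<open>
  Truncated subtraction on exponents is harmless here: a monomial not containing the
  variable \<open>i\<close> gets the coefficient \<open>0\<close>.
\<close>

definition partial :: "3 \<Rightarrow> polyS \<Rightarrow> polyS"
  where "partial i p = (\<Sum>u\<in>Poly_Mapping.keys p.
    Poly_Mapping.single (u - Poly_Mapping.single i 1)
      (of_nat (Poly_Mapping.lookup u i) * Poly_Mapping.lookup p u))"

definition linear_form :: "complex ^ 3 \<Rightarrow> polyS"
  where "linear_form a = (\<Sum>i\<in>UNIV. Poly_Mapping.single (Poly_Mapping.single i 1) (a $ i))"

definition AR_module :: "polyS \<Rightarrow> (polyS ^ 3) set"
  where "AR_module f = {\<rho>. (\<Sum>i\<in>UNIV. \<rho> $ i * partial i f) = 0}"

definition homogeneous_triple :: "nat \<Rightarrow> polyS ^ 3 \<Rightarrow> bool"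
  where "homogeneous_triple r \<rho> \<longleftrightarrow> (\<forall>i. homogeneous r (\<rho> $ i))"

definition mdr :: "polyS \<Rightarrow> nat"
  where "mdr f = (LEAST r. \<exists>\<rho>\<in>AR_module f. \<rho> \<noteq> 0 \<and> homogeneous_triple r \<rho>)"

global_interpretation polyS_vec: module "(*s) :: polyS \<Rightarrow> polyS ^ 3 \<Rightarrow> polyS ^ 3"
  by unfold_locales (simp_all add: vec_eq_iff algebra_simps)

text \<open>
  A graded module is free as a graded module iff it has a basis consisting of homogeneous
  elements.
\<close>

definition graded_free :: "(polyS ^ 3) set \<Rightarrow> bool"
  where "graded_free M \<longleftrightarrow> (\<exists>B. (\<forall>\<rho>\<in>B. \<exists>r. homogeneous_triple r \<rho>) \<and>
    \<not> polyS_vec.dependent B \<and> polyS_vec.span B = M)"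

text \<open>
  Points and lines of \<open>\<P>\<^sup>2\<close> over the complex numbers are the linear subspaces of \<open>\<complex>\<^sup>3\<close> of
  dimension 1 and 2; incidence is inclusion.
\<close>

type_synonym subsp = "(complex ^ 3) set"

definition proj_points :: "subsp set"
  where "proj_points = {p. vec.subspace p \<and> vec.dim p = 1}"

definition proj_lines :: "subsp set"
  where "proj_lines = {L. vec.subspace L \<and> vec.dim L = 2}"

definition line_arrangement :: "subsp set \<Rightarrow> bool"
  where "line_arrangement A \<longleftrightarrow> finite A \<and> A \<subseteq> proj_lines"

text \<open>
  \<open>A : f = 0\<close>, i.e. \<open>f\<close> is the product of linear forms defining the lines of \<open>A\<close>, one form
  (determined up to a nonzero scalar) for each line.
\<close>

definition defining_polynomial :: "subsp set \<Rightarrow> polyS \<Rightarrow> bool"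
  where "defining_polynomial A f \<longleftrightarrow> (\<exists>\<alpha>.
    (\<forall>L\<in>A. L = {v. (\<Sum>i\<in>UNIV. \<alpha> L $ i * v $ i) = 0}) \<and>
    f = (\<Prod>L\<in>A. linear_form (\<alpha> L)))"

definition multiplicity_at :: "subsp set \<Rightarrow> subsp \<Rightarrow> nat"
  where "multiplicity_at A p = card {L \<in> A. p \<subseteq> L}"

definition intersection_points :: "subsp set \<Rightarrow> subsp set"
  where "intersection_points A =
    {p \<in> proj_points. \<exists>L\<in>A. \<exists>L'\<in>A. L \<noteq> L' \<and> p \<subseteq> L \<and> p \<subseteq> L'}"

text \<open>
  For at least two lines this is a maximum; with fewer lines there is no intersection point
  and the value is \<open>Sup {} = 0\<close>.
\<close>

definition max_multiplicity :: "subsp set \<Rightarrow> nat"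
  where "max_multiplicity A = (SUP p\<in>intersection_points A. multiplicity_at A p)"

definition modular_point :: "subsp set \<Rightarrow> subsp \<Rightarrow> bool"
  where "modular_point A p \<longleftrightarrow> p \<in> intersection_points A \<and>
    (\<forall>p'\<in>intersection_points A. p' \<noteq> p \<longrightarrow> vec.span (p \<union> p') \<in> A)"

definition supersolvable :: "subsp set \<Rightarrow> bool"
  where "supersolvable A \<longleftrightarrow> (\<exists>p. modular_point A p)"

end

theory Submission
  imports Defs "HOL-Computational_Algebra.Fundamental_Theorem_Algebra"
begin

text \<open>
  Fix a point \<open>p\<close> spanned by \<open>v\<close>, let \<open>m\<close> be its multiplicity, and split \<open>f = g h\<close> into the lines
  through \<open>p\<close> and the others. For a triple \<open>t\<close> let \<open>u t\<close> be the determinant of \<open>(x, v, t)\<close>, where \<open>x\<close>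
  is the Euler triple. A syzygy \<open>t\<close> is a logarithmic vector field, hence \<open>g\<close> divides \<open>u t\<close>; and
  \<open>u t = 0\<close> only for the multiples of the syzygy \<open>D = d h v - (\<partial>\<^sub>v h) x\<close> of degree \<open>d - m\<close>. So
  \<open>min (m - 1) (d - m) \<le> mdr f \<le> d - m\<close> at every point.

  If \<open>u t\<close> is a nonzero constant multiple of \<open>g\<close>, then \<open>p\<close> is modular: at the intersection \<open>y\<close> of two
  lines not through \<open>p\<close>, the vector \<open>t y\<close> is proportional to \<open>y\<close>, so \<open>g\<close> vanishes at \<open>y\<close>. Such a \<open>t\<close>
  exists for degree reasons when \<open>mdr f = m - 1 < d - m\<close>. When \<open>mdr f = d - m\<close> and the syzygies are
  free, \<open>D\<close> can be made a basis element, so the image of \<open>u\<close> is a principal ideal, and comparing its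
  generator with the Koszul syzygies shows that it is \<open>g\<close> up to a constant. Conversely, for a modular point,
  interpolation along \<open>v\<close> extends the field \<open>w \<times> \<nabla>g\<close> (with \<open>w \<cdot> v = 1\<close>) to a syzygy of degree \<open>m - 1\<close>.
\<close>

subsection \<open>The polynomial ring\<close>

definition pconst :: "complex \<Rightarrow> polyS"
  where "pconst c = Poly_Mapping.single 0 c"

definition pvar :: "3 \<Rightarrow> polyS"
  where "pvar i = Poly_Mapping.single (Poly_Mapping.single i 1) 1"

lemma pconst_simps:
  "pconst 0 = 0" "pconst 1 = 1" "pconst (a + b) = pconst a + pconst b"
  "pconst (a * b) = pconst a * pconst b" "pconst (- a) = - pconst a"
  "pconst (a - b) = pconst a - pconst b" "pconst (of_nat n) = of_nat n"
  by (simp_all add: pconst_def single_add mult_single single_uminus single_diff)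

lemma pconst_eq_iff [simp]: "pconst a = pconst b \<longleftrightarrow> a = b" "pconst a = 0 \<longleftrightarrow> a = 0"
proof -
  show *: "pconst a = pconst b \<longleftrightarrow> a = b" for a b
    by (metis lookup_single_eq pconst_def)
  show "pconst a = 0 \<longleftrightarrow> a = 0"
    using *[of a 0] by (simp add: pconst_simps)
qed

lemma pconst_inverse: "c \<noteq> 0 \<Longrightarrow> pconst c * pconst (inverse c) = 1"
  by (simp add: pconst_simps(2) flip: pconst_simps(4))

lemma pvar_power: "pvar i ^ n = Poly_Mapping.single (Poly_Mapping.single i n) 1"
proof (induction n)
  case (Suc n)
  show ?case
    using Suc by (simp add: pvar_def mult_single flip: single_add)
qed simp

lemma prod_UNIV_3: "prod f (UNIV :: 3 set) = f 1 * f 2 * f 3"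
  unfolding UNIV_3 by (simp add: ac_simps)

lemma single_eq_pconst_times_pvars:
  fixes u :: "3 \<Rightarrow>\<^sub>0 nat"
  shows "Poly_Mapping.single u c = pconst c * (\<Prod>i\<in>UNIV. pvar i ^ Poly_Mapping.lookup u i)"
proof -
  have "u = Poly_Mapping.single 1 (Poly_Mapping.lookup u 1)
      + Poly_Mapping.single 2 (Poly_Mapping.lookup u 2)
      + Poly_Mapping.single 3 (Poly_Mapping.lookup u 3)"
  proof (rule poly_mapping_eqI)
    fix i :: 3
    show "Poly_Mapping.lookup u i = Poly_Mapping.lookup (Poly_Mapping.single 1 (Poly_Mapping.lookup u 1)
      + Poly_Mapping.single 2 (Poly_Mapping.lookup u 2)
      + Poly_Mapping.single 3 (Poly_Mapping.lookup u 3)) i"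
      using exhaust_3[of i] by (auto simp: lookup_add lookup_single when_def)
  qed
  then have "Poly_Mapping.single u c = Poly_Mapping.single (Poly_Mapping.single 1 (Poly_Mapping.lookup u 1)
      + Poly_Mapping.single 2 (Poly_Mapping.lookup u 2)
      + Poly_Mapping.single 3 (Poly_Mapping.lookup u 3)) c"
    by (rule arg_cong[where f = "\<lambda>w. Poly_Mapping.single w c"])
  also have "\<dots> = pconst c * (pvar 1 ^ Poly_Mapping.lookup u 1 * pvar 2 ^ Poly_Mapping.lookup u 2
      * pvar 3 ^ Poly_Mapping.lookup u 3)"
    by (simp only: pvar_power pconst_def mult_single mult_1_right add_0)
  also have "\<dots> = pconst c * (\<Prod>i\<in>UNIV. pvar i ^ Poly_Mapping.lookup u i)"
    by (simp only: prod_UNIV_3)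
  finally show ?thesis .
qed

lemma polyS_eq_sum_single:
  fixes p :: polyS
  shows "p = (\<Sum>u\<in>Poly_Mapping.keys p. Poly_Mapping.single u (Poly_Mapping.lookup p u))"
  by (rule poly_mapping_eqI)
    (simp add: lookup_sum lookup_single when_def in_keys_iff sum.delta' if_distrib cong: if_cong)

lemma polyS_single_induct [case_names single add]:
  fixes p :: polyS
  assumes "\<And>u c. P (Poly_Mapping.single u c)" "\<And>p q. P p \<Longrightarrow> P q \<Longrightarrow> P (p + q)"
  shows "P p"
proof -
  have "P (\<Sum>u\<in>K. Poly_Mapping.single u (Poly_Mapping.lookup p u))" if "finite K" for K
    using that by (induction K) (use assms(1)[of 0 0] assms in auto)
  then show ?thesis
    using polyS_eq_sum_single[of p] finite_keys by metis
qed

text \<open>Constants and variables generate the ring, so a statement compatible with sums and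
  products, such as a congruence between two homomorphisms, needs checking only on these.\<close>

lemma polyS_induct [case_names const var add mult]:
  fixes p :: polyS
  assumes "\<And>c. P (pconst c)" "\<And>i. P (pvar i)"
    "\<And>p q. P p \<Longrightarrow> P q \<Longrightarrow> P (p + q)" "\<And>p q. P p \<Longrightarrow> P q \<Longrightarrow> P (p * q)"
  shows "P p"
proof (induction p rule: polyS_single_induct)
  case (single u c)
  have P1: "P 1"
    using assms(1)[of 1] by (simp add: pconst_simps)
  have pow: "P (pvar i ^ n)" for i n
    by (induction n) (use P1 assms in auto)
  have "P (\<Prod>i\<in>I. pvar i ^ Poly_Mapping.lookup u i)" if "finite I" for I
    using that by (induction I) (use P1 pow assms in auto)
  then show ?case
    by (auto simp: single_eq_pconst_times_pvars intro: assms)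
qed (use assms in auto)

subsection \<open>Substitution homomorphisms\<close>

text \<open>The target ring is kept general because three instances occur: substitution into the
  ring itself, evaluation at a point, and restriction to a parametrised line as a univariate
  polynomial.\<close>

definition psub :: "(complex \<Rightarrow> 'a::comm_ring_1) \<Rightarrow> (3 \<Rightarrow> 'a) \<Rightarrow> polyS \<Rightarrow> 'a"
  where "psub \<kappa> \<sigma> p =
    (\<Sum>u\<in>Poly_Mapping.keys p. \<kappa> (Poly_Mapping.lookup p u) * (\<Prod>i\<in>UNIV. \<sigma> i ^ Poly_Mapping.lookup u i))"

locale coeff_hom =
  fixes \<kappa> :: "complex \<Rightarrow> 'a::comm_ring_1"
  assumes coeff_add: "\<kappa> (a + b) = \<kappa> a + \<kappa> b"
    and coeff_mult: "\<kappa> (a * b) = \<kappa> a * \<kappa> b"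
    and coeff_one: "\<kappa> 1 = 1"
begin

lemma coeff_zero: "\<kappa> 0 = 0"
  using coeff_add[of 0 0] by simp

lemma psub_superset:
  assumes "finite K" "Poly_Mapping.keys p \<subseteq> K"
  shows "psub \<kappa> \<sigma> p =
    (\<Sum>u\<in>K. \<kappa> (Poly_Mapping.lookup p u) * (\<Prod>i\<in>UNIV. \<sigma> i ^ Poly_Mapping.lookup u i))"
  unfolding psub_def
  by (rule sum.mono_neutral_left) (use assms in \<open>auto simp: in_keys_iff coeff_zero\<close>)

lemma psub_single: "psub \<kappa> \<sigma> (Poly_Mapping.single u c) = \<kappa> c * (\<Prod>i\<in>UNIV. \<sigma> i ^ Poly_Mapping.lookup u i)"
  by (subst psub_superset[of "{u}"]) auto

lemma psub_add [simp]: "psub \<kappa> \<sigma> (p + q) = psub \<kappa> \<sigma> p + psub \<kappa> \<sigma> q"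
proof -
  let ?K = "Poly_Mapping.keys p \<union> Poly_Mapping.keys q"
  have "Poly_Mapping.keys (p + q) \<subseteq> ?K"
    by (rule keys_add)
  then show ?thesis
    by (simp add: psub_superset[of ?K] lookup_add coeff_add algebra_simps sum.distrib)
qed

lemma psub_0 [simp]: "psub \<kappa> \<sigma> 0 = 0"
  by (simp add: psub_def)

lemma psub_pconst [simp]: "psub \<kappa> \<sigma> (pconst c) = \<kappa> c"
  by (simp add: pconst_def psub_single)

lemma psub_1 [simp]: "psub \<kappa> \<sigma> 1 = 1"
  using psub_pconst[of \<sigma> 1] by (simp add: pconst_simps coeff_one)

lemma psub_pvar [simp]: "psub \<kappa> \<sigma> (pvar i) = \<sigma> i"
proof -
  have "(\<Prod>j\<in>UNIV. \<sigma> j ^ (Poly_Mapping.lookup (Poly_Mapping.single i 1) j)) = (\<Prod>j\<in>UNIV. if j = i then \<sigma> i else 1)"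
    by (rule prod.cong) (auto simp: lookup_single when_def)
  then show ?thesis
    by (simp add: pvar_def psub_single coeff_one)
qed

lemma psub_mult [simp]: "psub \<kappa> \<sigma> (p * q) = psub \<kappa> \<sigma> p * psub \<kappa> \<sigma> q"
proof (induction p rule: polyS_single_induct)
  case (single u c)
  show ?case
  proof (induction q rule: polyS_single_induct)
    case (single w d)
    show ?case
      by (simp add: mult_single psub_single coeff_mult lookup_add power_add prod.distrib algebra_simps)
  qed (simp add: algebra_simps)
qed (simp add: algebra_simps)

lemma psub_uminus [simp]: "psub \<kappa> \<sigma> (- p) = - psub \<kappa> \<sigma> p"
  by (metis add_eq_0_iff psub_0 psub_add)

lemma psub_diff [simp]: "psub \<kappa> \<sigma> (p - q) = psub \<kappa> \<sigma> p - psub \<kappa> \<sigma> q"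
  by (metis psub_add psub_uminus uminus_add_conv_diff)

lemma psub_sum [simp]: "psub \<kappa> \<sigma> (\<Sum>x\<in>B. F x) = (\<Sum>x\<in>B. psub \<kappa> \<sigma> (F x))"
  by (induction B rule: infinite_finite_induct) auto

lemma psub_prod [simp]: "psub \<kappa> \<sigma> (\<Prod>x\<in>B. F x) = (\<Prod>x\<in>B. psub \<kappa> \<sigma> (F x))"
  by (induction B rule: infinite_finite_induct) auto

lemma psub_of_nat [simp]: "psub \<kappa> \<sigma> (of_nat n) = of_nat n"
  by (induction n) auto

end

abbreviation psubst :: "(3 \<Rightarrow> polyS) \<Rightarrow> polyS \<Rightarrow> polyS"
  where "psubst \<equiv> psub pconst"

definition peval :: "complex ^ 3 \<Rightarrow> polyS \<Rightarrow> complex"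
  where "peval y = psub id (\<lambda>i. y $ i)"

interpretation pconst: coeff_hom pconst
  by unfold_locales (simp_all add: pconst_simps)

interpretation cid: coeff_hom "id :: complex \<Rightarrow> complex"
  by unfold_locales simp_all

interpretation cpoly: coeff_hom "\<lambda>c. [:c::complex:]"
  by unfold_locales (simp_all add: one_pCons)

lemma peval_simps [simp]:
  "peval y (p + q) = peval y p + peval y q" "peval y (p * q) = peval y p * peval y q"
  "peval y (p - q) = peval y p - peval y q" "peval y (- p) = - peval y p"
  "peval y 0 = 0" "peval y 1 = 1" "peval y (pconst c) = c" "peval y (pvar i) = y $ i"
  "peval y (sum F B) = (\<Sum>x\<in>B. peval y (F x))" "peval y (prod F B) = (\<Prod>x\<in>B. peval y (F x))"
  "peval y (of_nat n) = of_nat n"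
  by (simp_all add: peval_def)

text \<open>A substitution that is the identity on the variables modulo \<open>l\<close> is the
  identity on all polynomials modulo \<open>l\<close>. This is what makes a projection onto a plane
  a reduction modulo its form.\<close>

lemma dvd_psubst_diff:
  assumes "\<And>i. l dvd \<sigma> i - pvar i"
  shows "l dvd psubst \<sigma> p - p"
proof (induction p rule: polyS_induct)
  case (var i)
  show ?case by (simp add: assms)
next
  case (add p q)
  then have "l dvd (psubst \<sigma> p - p) + (psubst \<sigma> q - q)" by (rule dvd_add)
  then show ?case by (simp add: algebra_simps)
next
  case (mult p q)
  then have "l dvd (psubst \<sigma> p - p) * psubst \<sigma> q + p * (psubst \<sigma> q - q)" by simp
  then show ?case by (simp add: algebra_simps)
qed simp

lemma poly_psub_line:
  "poly (psub (\<lambda>c. [:c:]) (\<lambda>i. [:y $ i, v $ i:]) p) t = peval (y + t *s v) p"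
  by (induction p rule: polyS_induct) auto

subsection \<open>Homogeneous components\<close>

definition hcomp :: "nat \<Rightarrow> polyS \<Rightarrow> polyS"
  where "hcomp n p = (\<Sum>u\<in>{u \<in> Poly_Mapping.keys p. monomial_degree u = n}.
    Poly_Mapping.single u (Poly_Mapping.lookup p u))"

lemma lookup_hcomp:
  "Poly_Mapping.lookup (hcomp n p) u = (if monomial_degree u = n then Poly_Mapping.lookup p u else 0)"
  by (auto simp: hcomp_def lookup_sum lookup_single when_def in_keys_iff sum.delta' if_distrib cong: if_cong)

lemma monomial_degree_add: "monomial_degree (u + w) = monomial_degree u + monomial_degree w"
  by (simp add: monomial_degree_def lookup_add sum.distrib)

lemma hcomp_add [simp]: "hcomp n (p + q) = hcomp n p + hcomp n q"
  by (rule poly_mapping_eqI) (simp add: lookup_hcomp lookup_add)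

lemma hcomp_0 [simp]: "hcomp n 0 = 0"
  by (rule poly_mapping_eqI) (simp add: lookup_hcomp)

lemma hcomp_sum: "hcomp n (\<Sum>x\<in>B. F x) = (\<Sum>x\<in>B. hcomp n (F x))"
  by (induction B rule: infinite_finite_induct) auto

lemma homogeneous_iff_lookup: "homogeneous n p \<longleftrightarrow> (\<forall>u. Poly_Mapping.lookup p u \<noteq> 0 \<longrightarrow> monomial_degree u = n)"
  by (auto simp: homogeneous_def in_keys_iff)

lemma homogeneous_hcomp [simp]: "homogeneous n (hcomp n p)"
  by (simp add: homogeneous_iff_lookup lookup_hcomp)

lemma homogeneous_0 [simp]: "homogeneous n 0"
  by (simp add: homogeneous_def)

lemma hcomp_homogeneous:
  assumes "homogeneous k p"
  shows "hcomp n p = (if n = k then p else 0)"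
  by (rule poly_mapping_eqI) (use assms in \<open>auto simp: lookup_hcomp homogeneous_iff_lookup\<close>)

lemma homogeneous_add: "homogeneous n p \<Longrightarrow> homogeneous n q \<Longrightarrow> homogeneous n (p + q)"
  by (simp add: homogeneous_iff_lookup lookup_add) (metis add_0)

lemma homogeneous_uminus: "homogeneous n p \<Longrightarrow> homogeneous n (- p)"
  by (simp add: homogeneous_iff_lookup)

lemma homogeneous_diff: "homogeneous n p \<Longrightarrow> homogeneous n q \<Longrightarrow> homogeneous n (p - q)"
  using homogeneous_add[of n p "- q"] homogeneous_uminus by simp

lemma homogeneous_sum: "(\<And>x. x \<in> B \<Longrightarrow> homogeneous n (F x)) \<Longrightarrow> homogeneous n (\<Sum>x\<in>B. F x)"
  by (induction B rule: infinite_finite_induct) (auto intro: homogeneous_add)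

lemma homogeneous_mult: "homogeneous a p \<Longrightarrow> homogeneous b q \<Longrightarrow> homogeneous (a + b) (p * q)"
  using keys_mult[of p q] by (fastforce simp: homogeneous_def monomial_degree_add)

lemma homogeneous_pconst [simp]: "homogeneous 0 (pconst c)"
  by (simp add: homogeneous_def pconst_def monomial_degree_def)

lemma homogeneous_1: "homogeneous 0 1"
  using homogeneous_pconst[of 1] by (simp add: pconst_simps)

lemma homogeneous_pvar [simp]: "homogeneous 1 (pvar i)"
  by (simp add: homogeneous_def pvar_def monomial_degree_def lookup_single when_def)

lemma homogeneous_prod:
  "finite B \<Longrightarrow> (\<And>x. x \<in> B \<Longrightarrow> homogeneous 1 (F x)) \<Longrightarrow> homogeneous (card B) (\<Prod>x\<in>B. F x)"
  by (induction B rule: finite_induct) (auto simp: homogeneous_1 intro: homogeneous_mult[of 1, simplified])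

lemma hcomp_mult_homogeneous:
  assumes "homogeneous b g"
  shows "hcomp (b + n) (g * s) = g * hcomp n s"
proof (induction s rule: polyS_single_induct)
  case (single u c)
  have 1: "homogeneous (monomial_degree u) (Poly_Mapping.single u c)"
    by (simp add: homogeneous_def)
  from hcomp_homogeneous[OF homogeneous_mult[OF assms 1]] hcomp_homogeneous[OF 1]
  show ?case by simp
qed (simp add: algebra_simps)

lemma hcomp_mult_homogeneous_less:
  assumes "homogeneous b g" "n < b"
  shows "hcomp n (g * s) = 0"
proof (induction s rule: polyS_single_induct)
  case (single u c)
  have 1: "homogeneous (monomial_degree u) (Poly_Mapping.single u c)"
    by (simp add: homogeneous_def)
  from hcomp_homogeneous[OF homogeneous_mult[OF assms(1) 1]] assms(2)
  show ?case by simp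
qed (simp add: algebra_simps)

text \<open>Multiplication by \<open>g\<close> shifts homogeneous components by \<open>b\<close>. So
  \<open>g * s\<close> has no component below degree \<open>b\<close>, and cancelling
  \<open>g\<close> in its only component shows that \<open>s\<close> is its own component. All
  degree comparisons below rest on this.\<close>

lemma homogeneous_quotient:
  assumes "homogeneous b g" "homogeneous a (g * s)" "g * s \<noteq> 0"
  shows "b \<le> a" "homogeneous (a - b) s"
proof -
  have 1: "hcomp a (g * s) = g * s"
    using assms(2) by (simp add: hcomp_homogeneous)
  then show le: "b \<le> a"
    using hcomp_mult_homogeneous_less[OF assms(1), of a s] assms(3) by fastforce
  then have "g * hcomp (a - b) s = g * s"
    using 1 hcomp_mult_homogeneous[OF assms(1), of "a - b" s] by (metis le_add_diff_inverse)
  moreover have "g \<noteq> 0"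
    using assms(3) by auto
  ultimately have "hcomp (a - b) s = s"
    by (simp only: mult_cancel_left simp_thms)
  then show "homogeneous (a - b) s"
    by (metis homogeneous_hcomp)
qed

lemma homogeneous_0_eq_pconst:
  assumes "homogeneous 0 p"
  obtains c where "p = pconst c"
proof
  show "p = pconst (Poly_Mapping.lookup p 0)"
  proof (rule poly_mapping_eqI)
    fix u :: "3 \<Rightarrow>\<^sub>0 nat"
    show "Poly_Mapping.lookup p u = Poly_Mapping.lookup (pconst (Poly_Mapping.lookup p 0)) u"
    proof (cases "u = 0")
      case False
      then obtain i where "Poly_Mapping.lookup u i \<noteq> 0"
        by (metis lookup_zero poly_mapping_eqI)
      then have "monomial_degree u \<noteq> 0"
        by (auto simp: monomial_degree_def)
      then show ?thesis
        using assms False by (auto simp: homogeneous_iff_lookup pconst_def lookup_single when_def)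
    qed (simp add: pconst_def)
  qed
qed

lemma peval_scale:
  assumes "homogeneous n p"
  shows "peval (t *s y) p = t ^ n * peval y p"
proof -
  have "(\<Prod>i\<in>UNIV. ((t *s y) $ i) ^ Poly_Mapping.lookup u i) =
      t ^ monomial_degree u * (\<Prod>i\<in>UNIV. (y $ i) ^ Poly_Mapping.lookup u i)" for u
    by (simp add: power_mult_distrib prod.distrib power_sum monomial_degree_def)
  then show ?thesis
    using assms unfolding peval_def psub_def homogeneous_def
    by (auto simp: sum_distrib_left intro!: sum.cong)
qed

subsection \<open>Derivations\<close>

lemma partial_superset:
  assumes "finite K" "Poly_Mapping.keys p \<subseteq> K"
  shows "partial i p = (\<Sum>u\<in>K. Poly_Mapping.single (u - Poly_Mapping.single i 1)
      (of_nat (Poly_Mapping.lookup u i) * Poly_Mapping.lookup p u))"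
  unfolding partial_def
  by (rule sum.mono_neutral_left) (use assms in \<open>auto simp: in_keys_iff\<close>)

lemma partial_single:
  "partial i (Poly_Mapping.single u c) =
    Poly_Mapping.single (u - Poly_Mapping.single i 1) (of_nat (Poly_Mapping.lookup u i) * c)"
  by (subst partial_superset[of "{u}"]) auto

lemma partial_add [simp]: "partial i (p + q) = partial i p + partial i q"
proof -
  let ?K = "Poly_Mapping.keys p \<union> Poly_Mapping.keys q"
  have "Poly_Mapping.keys (p + q) \<subseteq> ?K"
    by (rule keys_add)
  then show ?thesis
    by (simp add: partial_superset[of ?K] lookup_add algebra_simps sum.distrib single_add)
qed

lemma diff_single_add:
  fixes u w :: "3 \<Rightarrow>\<^sub>0 nat"
  assumes "Poly_Mapping.lookup u i \<noteq> 0"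
  shows "u - Poly_Mapping.single i 1 + w = u + w - Poly_Mapping.single i 1"
  by (rule poly_mapping_eqI)
    (use assms in \<open>auto simp: lookup_add lookup_minus lookup_single when_def\<close>)

lemma partial_mult: "partial i (p * q) = partial i p * q + p * partial i q"
proof (induction p rule: polyS_single_induct)
  case (single u c)
  show ?case
  proof (induction q rule: polyS_single_induct)
    case (single w d)
    let ?e = "Poly_Mapping.single i (1::nat)"
    \<comment> \<open>Truncated subtraction commutes with addition only if the exponent of the
      variable is positive; if it is 0, the coefficients on both sides vanish.\<close>
    have 1: "Poly_Mapping.single (u - ?e + w) (of_nat (Poly_Mapping.lookup u i) * c * d)
        = Poly_Mapping.single (u + w - ?e) (of_nat (Poly_Mapping.lookup u i) * c * d)"
      using diff_single_add[of u i w] by (cases "Poly_Mapping.lookup u i = 0") auto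
    have 2: "Poly_Mapping.single (u + (w - ?e)) (of_nat (Poly_Mapping.lookup w i) * c * d)
        = Poly_Mapping.single (u + w - ?e) (of_nat (Poly_Mapping.lookup w i) * c * d)"
      using diff_single_add[of w i u] by (cases "Poly_Mapping.lookup w i = 0") (auto simp: add.commute)
    show ?case
      using 1 2 by (simp add: mult_single partial_single lookup_add algebra_simps flip: single_add)
  qed (simp add: algebra_simps)
qed (simp add: algebra_simps)

lemma partial_pconst [simp]: "partial i (pconst c) = 0"
  by (simp add: pconst_def partial_single)

lemma partial_pvar [simp]: "partial i (pvar j) = (if i = j then 1 else 0)"
  by (simp add: pvar_def partial_single lookup_single when_def)

text \<open>For \<open>n = 0\<close> the truncated degree \<open>n - 1\<close> does no harm: the
  derivative is then the zero polynomial, which is homogeneous of every degree.\<close>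

lemma homogeneous_partial:
  assumes "homogeneous n p"
  shows "homogeneous (n - 1) (partial i p)"
  unfolding partial_def
proof (rule homogeneous_sum)
  fix u assume u: "u \<in> Poly_Mapping.keys p"
  then have n: "monomial_degree u = n"
    using assms by (simp add: homogeneous_def)
  have "monomial_degree (u - Poly_Mapping.single i 1) = n - 1" if "Poly_Mapping.lookup u i \<noteq> 0"
  proof -
    have "u - Poly_Mapping.single i 1 + Poly_Mapping.single i 1 = u"
      by (rule poly_mapping_eqI) (use that in \<open>auto simp: lookup_add lookup_minus lookup_single when_def\<close>)
    then have "monomial_degree (u - Poly_Mapping.single i 1) + monomial_degree (Poly_Mapping.single i 1) = n"
      by (metis monomial_degree_add n)
    then show ?thesis
      by (auto simp: monomial_degree_def[of "Poly_Mapping.single i _"] lookup_single when_def)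
  qed
  then show "homogeneous (n - 1) (Poly_Mapping.single (u - Poly_Mapping.single i 1)
      (of_nat (Poly_Mapping.lookup u i) * Poly_Mapping.lookup p u))"
    by (auto simp: homogeneous_def)
qed

subsection \<open>Vector algebra in dimension three\<close>

text \<open>The products are defined over any commutative ring, as they serve both complex vectors
  and triples of polynomials.\<close>

definition dotp :: "'a::comm_ring_1 ^ 3 \<Rightarrow> 'a ^ 3 \<Rightarrow> 'a"
  where "dotp a b = (\<Sum>i\<in>UNIV. a $ i * b $ i)"

definition crossp :: "'a::comm_ring_1 ^ 3 \<Rightarrow> 'a ^ 3 \<Rightarrow> 'a ^ 3"
  where "crossp a b = vector [a $ 2 * b $ 3 - a $ 3 * b $ 2, a $ 3 * b $ 1 - a $ 1 * b $ 3,
    a $ 1 * b $ 2 - a $ 2 * b $ 1]"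

lemmas vec3_defs = dotp_def crossp_def sum_3 vec_eq_iff forall_3

lemma dotp_simps [simp]:
  "dotp (a + b) c = dotp a c + dotp b c" "dotp c (a + b) = dotp c a + dotp c b"
  "dotp (a - b) c = dotp a c - dotp b c" "dotp c (a - b) = dotp c a - dotp c b"
  "dotp (- a) c = - dotp a c" "dotp c (- a) = - dotp c a"
  "dotp 0 c = 0" "dotp c 0 = 0"
  "dotp (r *s a) c = r * dotp a c" "dotp c (r *s a) = r * dotp c a"
  by (simp_all add: vec3_defs algebra_simps)

lemma dotp_commute: "dotp a b = dotp b a"
  by (simp add: dotp_def mult.commute)

lemma crossp_simps [simp]:
  "crossp (a + b) c = crossp a c + crossp b c" "crossp c (a + b) = crossp c a + crossp c b"
  "crossp (a - b) c = crossp a c - crossp b c" "crossp c (a - b) = crossp c a - crossp c b"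
  "crossp 0 c = 0" "crossp c 0 = 0"
  "crossp (r *s a) c = r *s crossp a c" "crossp c (r *s a) = r *s crossp c a"
  by (simp_all add: vec3_defs algebra_simps)

lemma crossp_self [simp]: "crossp a a = 0"
  by (simp add: vec3_defs)

lemma crossp_commute: "crossp a b = - crossp b a"
  by (simp add: vec3_defs algebra_simps)

lemma dotp_crossp_self [simp]: "dotp a (crossp a b) = 0" "dotp b (crossp a b) = 0"
  by (simp_all add: vec3_defs algebra_simps)

lemma dotp_crossp_rotate: "dotp a (crossp b c) = dotp b (crossp c a)"
  by (simp add: vec3_defs algebra_simps)

lemma crossp_crossp: "crossp a (crossp b c) = dotp a c *s b - dotp a b *s c"
  by (simp add: vec3_defs algebra_simps)

text \<open>Cramer's rule for a covector \<open>a\<close>: its values on \<open>x\<close>,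
  \<open>v\<close>, \<open>t\<close> are its coordinates in the dual basis, up to the determinant.
  If these values vanish or are divisible by a form, so is the determinant times
  \<open>a\<close>.\<close>

lemma cramer3:
  "dotp x (crossp v t) *s a = dotp a x *s crossp v t + dotp a v *s crossp t x + dotp a t *s crossp x v"
  by (simp add: vec3_defs algebra_simps)

lemma obtain_dual:
  fixes a :: "complex ^ 3"
  assumes "a \<noteq> 0"
  obtains w where "dotp a w = 1"
proof -
  obtain i where i: "a $ i \<noteq> 0"
    using assms by (auto simp: vec_eq_iff)
  have "dotp a (axis i (1 / a $ i)) = (\<Sum>j\<in>UNIV. if j = i then 1 else 0)"
    unfolding dotp_def by (rule sum.cong) (use i in \<open>auto simp: axis_def\<close>)
  then show ?thesis
    using that by simp
qed

lemma crossp_eq_0_imp_parallel: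
  fixes a b :: "complex ^ 3"
  assumes "crossp a b = 0" "a \<noteq> 0"
  obtains c where "b = c *s a"
proof -
  obtain w where w: "dotp a w = 1"
    using obtain_dual assms(2) by blast
  have "crossp w (crossp a b) = dotp w b *s a - b"
    using w by (simp add: crossp_crossp dotp_commute)
  then have "b = dotp w b *s a"
    using assms(1) by simp
  then show ?thesis
    by (rule that)
qed

text \<open>The cross product of \<open>v\<close> and \<open>y\<close> is nonzero; with
  \<open>e\<close> dual to it, the form \<open>crossp e v\<close> vanishes at \<open>v\<close> and
  takes the value 1 at \<open>y\<close>.\<close>

lemma obtain_separating_form:
  fixes v y :: "complex ^ 3"
  assumes "v \<noteq> 0" "\<And>c. y \<noteq> c *s v"
  obtains b where "dotp b v = 0" "dotp b y \<noteq> 0"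
proof -
  have "crossp v y \<noteq> 0"
    using assms crossp_eq_0_imp_parallel by metis
  then obtain e where e: "dotp (crossp v y) e = 1"
    using obtain_dual by blast
  show ?thesis
  proof
    show "dotp (crossp e v) v = 0"
      by (simp add: dotp_commute[of _ v])
    show "dotp (crossp e v) y \<noteq> 0"
      using e dotp_crossp_rotate[of y e v] by (simp add: dotp_commute)
  qed
qed

text \<open>On the curve of points \<open>(1, t, t^2)\<close> each nonzero form restricts to a
  nonzero polynomial in \<open>t\<close>, so finitely many forms exclude finitely many
  parameters.\<close>

lemma obtain_avoiding_point:
  fixes B :: "(complex ^ 3) set"
  assumes "finite B" "0 \<notin> B"
  obtains y where "\<And>b. b \<in> B \<Longrightarrow> dotp b y \<noteq> 0"
proof -
  let ?p = "\<lambda>b :: complex ^ 3. [:b $ 1, b $ 2, b $ 3:]"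
  have "?p b \<noteq> 0" if "b \<in> B" for b
  proof
    assume "?p b = 0"
    then have "b = 0"
      by (simp add: vec_eq_iff forall_3)
    then show False
      using that assms(2) by simp
  qed
  then have "finite (\<Union>b\<in>B. {t. poly (?p b) t = 0})"
    using assms(1) poly_roots_finite by blast
  then obtain t where t: "t \<notin> (\<Union>b\<in>B. {t. poly (?p b) t = 0})"
    using ex_new_if_finite infinite_UNIV_char_0 by blast
  show ?thesis
  proof
    fix b assume "b \<in> B"
    then show "dotp b (vector [1, t, t * t]) \<noteq> 0"
      using t by (simp add: vec3_defs algebra_simps)
  qed
qed

subsection \<open>Linear forms and gradients\<close>

definition cvec :: "complex ^ 3 \<Rightarrow> polyS ^ 3"
  where "cvec a = (\<chi> i. pconst (a $ i))"

definition xvec :: "polyS ^ 3"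
  where "xvec = (\<chi> i. pvar i)"

definition grad :: "polyS \<Rightarrow> polyS ^ 3"
  where "grad f = (\<chi> i. partial i f)"

definition veval :: "complex ^ 3 \<Rightarrow> polyS ^ 3 \<Rightarrow> complex ^ 3"
  where "veval y t = (\<chi> i. peval y (t $ i))"

definition vhcomp :: "nat \<Rightarrow> polyS ^ 3 \<Rightarrow> polyS ^ 3"
  where "vhcomp n t = (\<chi> i. hcomp n (t $ i))"

abbreviation lin :: "complex ^ 3 \<Rightarrow> polyS"
  where "lin \<equiv> linear_form"

lemma lin_eq_dotp: "lin a = dotp (cvec a) xvec"
  by (simp add: linear_form_def dotp_def cvec_def xvec_def pconst_def pvar_def mult_single)

lemma cvec_simps [simp]:
  "cvec (a + b) = cvec a + cvec b" "cvec (a - b) = cvec a - cvec b" "cvec 0 = 0"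
  "cvec (c *s a) = pconst c *s cvec a"
  by (simp_all add: cvec_def vec_eq_iff pconst_simps)

lemma dotp_cvec_cvec [simp]: "dotp (cvec a) (cvec b) = pconst (dotp a b)"
  by (simp add: vec3_defs cvec_def pconst_simps)

lemma crossp_cvec_cvec [simp]: "crossp (cvec a) (cvec b) = cvec (crossp a b)"
  by (simp add: vec3_defs cvec_def pconst_simps)

lemma lin_simps [simp]:
  "lin (a + b) = lin a + lin b" "lin (a - b) = lin a - lin b" "lin 0 = 0"
  "lin (c *s a) = pconst c * lin a"
  by (simp_all add: lin_eq_dotp)

lemma veval_simps [simp]:
  "veval y (s + t) = veval y s + veval y t" "veval y (s - t) = veval y s - veval y t"
  "veval y (p *s t) = peval y p *s veval y t" "veval y (cvec a) = a" "veval y xvec = y"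
  "veval y 0 = 0"
  by (simp_all add: veval_def cvec_def xvec_def vec_eq_iff)

lemma peval_dotp [simp]: "peval y (dotp s t) = dotp (veval y s) (veval y t)"
  by (simp add: dotp_def veval_def)

lemma veval_crossp [simp]: "veval y (crossp s t) = crossp (veval y s) (veval y t)"
  by (simp add: vec3_defs veval_def)

lemma peval_lin [simp]: "peval y (lin a) = dotp a y"
  by (simp add: lin_eq_dotp)

lemma homogeneous_lin [simp]: "homogeneous 1 (lin a)"
  unfolding lin_eq_dotp dotp_def cvec_def xvec_def
  by (rule homogeneous_sum) (use homogeneous_mult[OF homogeneous_pconst homogeneous_pvar] in simp)

lemma lin_eq_0_iff [simp]: "lin a = 0 \<longleftrightarrow> a = 0"
proof
  assume 0: "lin a = 0"
  show "a = 0"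
  proof (rule ccontr)
    assume "a \<noteq> 0"
    then obtain w where "dotp a w = 1"
      by (rule obtain_dual)
    then have "peval w (lin a) = 1"
      by simp
    then show False
      using 0 by simp
  qed
qed simp

lemma grad_add [simp]: "grad (p + q) = grad p + grad q"
  by (simp add: grad_def vec_eq_iff)

lemma grad_mult [simp]: "grad (p * q) = p *s grad q + q *s grad p"
  by (simp add: grad_def vec_eq_iff partial_mult algebra_simps)

lemma grad_pconst [simp]: "grad (pconst c) = 0"
  by (simp add: grad_def vec_eq_iff)

lemma grad_0_1 [simp]: "grad 0 = 0" "grad 1 = 0"
  using grad_pconst[of 0] grad_pconst[of 1] by (simp_all add: pconst_simps)

lemma grad_pvar: "grad (pvar i) = axis i 1"
  by (auto simp: grad_def vec_eq_iff axis_def)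

lemma grad_lin [simp]: "grad (lin a) = cvec a"
proof -
  have "grad (lin a) = (\<Sum>i\<in>UNIV. pconst (a $ i) *s axis i 1)"
    by (simp add: lin_eq_dotp dotp_def sum_3 cvec_def xvec_def grad_pvar)
  also have "\<dots> = cvec a"
    by (simp add: vec_eq_iff cvec_def axis_def if_distrib sum.delta' cong: if_cong)
  finally show ?thesis .
qed

lemma dotp_grad_prod_lin:
  assumes "finite B"
  shows "dotp t (grad (\<Prod>L\<in>B. lin (a L))) = (\<Sum>L\<in>B. dotp (cvec (a L)) t * (\<Prod>K\<in>B - {L}. lin (a K)))"
  using assms
proof (induction B rule: finite_induct)
  case (insert M B)
  have "(\<Prod>K\<in>insert M B - {L}. lin (a K)) = lin (a M) * (\<Prod>K\<in>B - {L}. lin (a K))" if "L \<in> B" for L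
  proof -
    have "insert M B - {L} = insert M (B - {L})"
      using that insert by auto
    then show ?thesis
      using insert by simp
  qed
  moreover have "insert M B - {M} = B"
    using insert by auto
  ultimately show ?case
    using insert by (simp add: sum_distrib_left dotp_commute algebra_simps cong: sum.cong)
qed simp

lemma euler_prod_lin:
  assumes "finite B"
  shows "dotp xvec (grad (\<Prod>L\<in>B. lin (a L))) = of_nat (card B) * (\<Prod>L\<in>B. lin (a L))"
proof -
  have "dotp (cvec (a L)) xvec * (\<Prod>K\<in>B - {L}. lin (a K)) = (\<Prod>L\<in>B. lin (a L))" if "L \<in> B" for L
    using that assms by (simp add: prod.remove[of B L] flip: lin_eq_dotp)
  then show ?thesis
    by (simp add: dotp_grad_prod_lin[OF assms])
qed

lemma homogeneous_triple_iff_vhcomp: "homogeneous_triple n t \<longleftrightarrow> vhcomp n t = t"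
proof
  show "vhcomp n t = t" if "homogeneous_triple n t"
    using that by (auto simp: homogeneous_triple_def vhcomp_def vec_eq_iff intro: hcomp_homogeneous[THEN trans])
  show "homogeneous_triple n t" if "vhcomp n t = t"
    by (subst that[symmetric]) (simp add: homogeneous_triple_def vhcomp_def)
qed

lemma homogeneous_triple_vhcomp [simp]: "homogeneous_triple n (vhcomp n t)"
  by (simp add: homogeneous_triple_def vhcomp_def)

lemma homogeneous_dotp:
  assumes "homogeneous_triple m s" "homogeneous_triple n t"
  shows "homogeneous (m + n) (dotp s t)"
  unfolding dotp_def using assms
  by (intro homogeneous_sum homogeneous_mult) (auto simp: homogeneous_triple_def)

lemma homogeneous_triple_crossp:
  assumes "homogeneous_triple m s" "homogeneous_triple n t"
  shows "homogeneous_triple (m + n) (crossp s t)"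
  using assms
  by (auto simp: homogeneous_triple_def crossp_def forall_3 intro!: homogeneous_diff homogeneous_mult)

lemma homogeneous_triple_cvec [simp]: "homogeneous_triple 0 (cvec a)"
  by (simp add: homogeneous_triple_def cvec_def)

lemma homogeneous_triple_xvec [simp]: "homogeneous_triple 1 xvec"
  by (simp add: homogeneous_triple_def xvec_def del: One_nat_def)

lemma homogeneous_triple_grad:
  "homogeneous n f \<Longrightarrow> homogeneous_triple (n - 1) (grad f)"
  using homogeneous_partial by (simp only: homogeneous_triple_def grad_def vec_lambda_beta simp_thms)

lemma hcomp_dotp_homogeneous:
  assumes "homogeneous_triple m s"
  shows "hcomp (m + n) (dotp s t) = dotp s (vhcomp n t)"
  using assms
  by (simp add: dotp_def vhcomp_def hcomp_sum hcomp_mult_homogeneous homogeneous_triple_def)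

subsection \<open>Divisibility by linear forms\<close>

text \<open>Reduction modulo \<open>lin a\<close> is the substitution projecting onto its zero plane along \<open>w\<close>.\<close>

definition plane_proj :: "complex ^ 3 \<Rightarrow> complex ^ 3 \<Rightarrow> polyS \<Rightarrow> polyS"
  where "plane_proj a w = psubst (\<lambda>i. pvar i - pconst (w $ i) * lin a)"

lemma plane_proj_simps [simp]:
  "plane_proj a w (p + q) = plane_proj a w p + plane_proj a w q"
  "plane_proj a w (p - q) = plane_proj a w p - plane_proj a w q"
  "plane_proj a w (p * q) = plane_proj a w p * plane_proj a w q"
  "plane_proj a w 0 = 0" "plane_proj a w 1 = 1" "plane_proj a w (pconst c) = pconst c"
  "plane_proj a w (\<Prod>x\<in>B. F x) = (\<Prod>x\<in>B. plane_proj a w (F x))"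
  by (simp_all add: plane_proj_def)

lemma plane_proj_lin [simp]: "plane_proj a w (lin b) = lin (b - dotp b w *s a)"
proof -
  have "plane_proj a w (lin b) = lin b - pconst (dotp b w) * lin a"
    by (simp add: plane_proj_def lin_eq_dotp[of b] vec3_defs cvec_def xvec_def pconst_simps algebra_simps)
  then show ?thesis
    by simp
qed

lemma lin_dvd_plane_proj_diff: "lin a dvd plane_proj a w p - p"
  unfolding plane_proj_def by (rule dvd_psubst_diff) simp

text \<open>The normalisation \<open>dotp a w = 1\<close> makes the projection kill
  \<open>lin a\<close>; conversely the projection changes \<open>p\<close> only by a multiple of
  \<open>lin a\<close>.\<close>

lemma lin_dvd_iff:
  assumes "dotp a w = 1"
  shows "lin a dvd p \<longleftrightarrow> plane_proj a w p = 0"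
proof
  assume "lin a dvd p"
  then show "plane_proj a w p = 0"
    using assms by (auto simp: dvd_def)
next
  assume "plane_proj a w p = 0"
  then show "lin a dvd p"
    using lin_dvd_plane_proj_diff[of a w p] by simp
qed

text \<open>Divisibility by \<open>lin a\<close> is membership in the kernel of a ring homomorphism
  into an integral domain.\<close>

lemma prime_elem_lin:
  assumes "a \<noteq> 0"
  shows "prime_elem (lin a)"
proof -
  obtain w where w: "dotp a w = 1"
    using obtain_dual assms by blast
  show ?thesis
    unfolding prime_elem_def lin_dvd_iff[OF w] using assms by simp
qed

lemma lin_dvd_lin_imp:
  assumes "a \<noteq> 0" "lin a dvd lin b"
  obtains c where "b = c *s a"
proof -
  obtain w where w: "dotp a w = 1"
    using obtain_dual assms by blast
  then have "b - dotp b w *s a = 0"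
    using assms(2) by (simp only: lin_dvd_iff[OF w] plane_proj_lin lin_eq_0_iff)
  then show ?thesis
    using that by auto
qed

lemma dvd_pconst_mult_iff:
  assumes "c \<noteq> 0"
  shows "p dvd pconst c * q \<longleftrightarrow> p dvd q"
proof
  assume "p dvd pconst c * q"
  then have "p dvd (pconst c * pconst (inverse c)) * q"
    using dvd_mult2[of p "pconst c * q" "pconst (inverse c)"] by (simp add: mult_ac)
  then show "p dvd q"
    using assms by (simp add: pconst_inverse)
qed simp

section \<open>Divisibility by products of primes\<close>

lemma prod_prime_dvd_mult:
  fixes q X :: "'a::idom"
  assumes "finite B" "\<And>L. L \<in> B \<Longrightarrow> prime_elem (F L)" "\<And>L. L \<in> B \<Longrightarrow> \<not> F L dvd q"
    "(\<Prod>L\<in>B. F L) dvd q * X"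
  shows "(\<Prod>L\<in>B. F L) dvd X"
  using assms
proof (induction B arbitrary: X rule: finite_induct)
  case (insert M B)
  have "F M dvd q * X"
    using insert by (auto intro: dvd_mult_left)
  then have "F M dvd X"
    using insert by (simp add: prime_elem_dvd_mult_iff)
  then obtain Y where Y: "X = F M * Y" ..
  have "F M * (\<Prod>L\<in>B. F L) dvd F M * (q * Y)"
    using insert.prems(3) insert.hyps Y by (simp add: mult.left_commute)
  moreover have "F M \<noteq> 0"
    using insert.prems(1)[of M] by (simp add: prime_elem_def)
  ultimately have "(\<Prod>L\<in>B. F L) dvd q * Y"
    by (simp only: dvd_mult_cancel_left simp_thms)
  then have "(\<Prod>L\<in>B. F L) dvd Y"
    using insert.IH[of Y] insert.prems(1,2) by simp
  then show ?case
    using insert.hyps Y by simp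
qed simp

lemma prime_elem_dvd_prod:
  fixes p :: "'a::idom"
  assumes "finite B" "prime_elem p" "p dvd (\<Prod>L\<in>B. F L)"
  shows "\<exists>L\<in>B. p dvd F L"
  using assms(1,3)
proof (induction B rule: finite_induct)
  case empty
  then show ?case
    using assms(2) by (simp add: prime_elem_not_unit)
next
  case (insert M B)
  then show ?case
    using prime_elem_dvd_mult_iff[OF assms(2), of "F M"] by auto
qed

text \<open>Primes in the same class may be associated, so divisibility by each class product is
  assumed; products of different classes are coprime and can be collected one class after another.
  Distinct lines are handled with singleton classes, the interpolation below with one class per line
  through the point.\<close>

lemma grouped_prod_prime_dvd:
  fixes X :: "'a::idom"
  assumes "finite J" "\<And>j. j \<in> J \<Longrightarrow> prime_elem (F j)"
    "\<And>i j. i \<in> J \<Longrightarrow> j \<in> J \<Longrightarrow> k i \<noteq> k j \<Longrightarrow> \<not> F i dvd F j"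
    "\<And>c. (\<Prod>j\<in>{j \<in> J. k j = c}. F j) dvd X"
  shows "(\<Prod>j\<in>J. F j) dvd X"
proof -
  have "(\<Prod>j\<in>{j \<in> J. k j \<in> C}. F j) dvd X" if "finite C" for C
    using that
  proof (induction C rule: finite_induct)
    case (insert c C)
    have split: "(\<Prod>j\<in>{j \<in> J. k j \<in> insert c C}. F j) = (\<Prod>j\<in>{j \<in> J. k j \<in> C}. F j) * (\<Prod>j\<in>{j \<in> J. k j = c}. F j)"
      by (subst prod.union_disjoint[symmetric])
        (use insert assms(1) in \<open>auto intro!: prod.cong\<close>)
    from insert.IH obtain Y where Y: "X = (\<Prod>j\<in>{j \<in> J. k j \<in> C}. F j) * Y" ..
    have "(\<Prod>j\<in>{j \<in> J. k j = c}. F j) dvd Y"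
    proof (rule prod_prime_dvd_mult)
      show "(\<Prod>j\<in>{j \<in> J. k j = c}. F j) dvd (\<Prod>j\<in>{j \<in> J. k j \<in> C}. F j) * Y"
        using assms(4) Y by simp
      show "\<not> F L dvd (\<Prod>j\<in>{j \<in> J. k j \<in> C}. F j)" if "L \<in> {j \<in> J. k j = c}" for L
        using that insert.hyps assms(1-3) prime_elem_dvd_prod[of "{j \<in> J. k j \<in> C}" "F L" F] by fastforce
    qed (use assms(1,2) in auto)
    then show ?case
      using split Y by simp
  qed simp
  from this[of "k ` J"] assms(1) have "(\<Prod>j\<in>{j \<in> J. k j \<in> k ` J}. F j) dvd X"
    by simp
  also have "{j \<in> J. k j \<in> k ` J} = J"
    by auto
  finally show ?thesis .
qed

text \<open>Linear dependence gives such a combination at first only over the fraction field. The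
  coefficients are polynomials because two of the minors of \<open>xvec\<close> and \<open>v\<close>
  are non-associated prime linear forms, and the remaining division is by a nonzero coordinate of
  \<open>v\<close>.\<close>

lemma triple_eq_combination:
  fixes v :: "complex ^ 3"
  assumes "v \<noteq> 0" "dotp xvec (crossp (cvec v) t) = 0"
  obtains q w where "t = q *s xvec + w *s cvec v"
proof -
  have main: "\<exists>q w. t = q *s xvec + w *s cvec v"
    if vk: "v $ k \<noteq> 0" and ijk: "UNIV = {i, j, k}" "i \<noteq> j" "i \<noteq> k" "j \<noteq> k"
      and minors: "(pvar i * pconst (v $ k) - pvar k * pconst (v $ i)) * (t $ j * pconst (v $ k) - t $ k * pconst (v $ j))
        = (pvar j * pconst (v $ k) - pvar k * pconst (v $ j)) * (t $ i * pconst (v $ k) - t $ k * pconst (v $ i))"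
    for i j k
  proof -
    \<comment> \<open>\<open>lin (y l)\<close> is the minor of \<open>xvec\<close> and
      \<open>cvec v\<close> in the coordinates \<open>l\<close> and \<open>k\<close>.\<close>
    define y where "y = (\<lambda>l. v $ k *s axis l 1 - v $ l *s axis k 1)"
    have lin_axis: "lin (axis l 1) = pvar l" for l
    proof -
      have "lin (axis l 1) = (\<Sum>m\<in>UNIV. if m = l then pvar m else 0)"
        unfolding lin_eq_dotp dotp_def
        by (rule sum.cong) (auto simp: cvec_def xvec_def axis_def pconst_simps)
      then show ?thesis by simp
    qed
    have lin_y: "lin (y l) = pvar l * pconst (v $ k) - pvar k * pconst (v $ l)" for l
      by (simp add: y_def lin_axis algebra_simps)
    have yi: "y i \<noteq> 0"
      using vk ijk by (auto simp: y_def vec_eq_iff axis_def dest: spec[of _ i])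
    have yj: "\<not> lin (y i) dvd lin (y j)"
    proof
      assume "lin (y i) dvd lin (y j)"
      then obtain c where "y j = c *s y i"
        using lin_dvd_lin_imp[OF yi] by blast
      then have "y j $ j = c * y i $ j"
        by simp
      then show False
        using vk ijk by (auto simp: y_def axis_def)
    qed
    have eq: "lin (y i) * (t $ j * pconst (v $ k) - t $ k * pconst (v $ j))
        = lin (y j) * (t $ i * pconst (v $ k) - t $ k * pconst (v $ i))"
      using minors by (simp only: lin_y)
    then have "lin (y i) dvd lin (y j) * (t $ i * pconst (v $ k) - t $ k * pconst (v $ i))"
      by (metis dvd_triv_left)
    then have "lin (y i) dvd t $ i * pconst (v $ k) - t $ k * pconst (v $ i)"
      using prime_elem_lin[OF yi] yj by (simp add: prime_elem_dvd_mult_iff)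
    then obtain q where q: "t $ i * pconst (v $ k) - t $ k * pconst (v $ i) = lin (y i) * q" ..
    have "lin (y i) * (t $ j * pconst (v $ k) - t $ k * pconst (v $ j)) = lin (y i) * (lin (y j) * q)"
      unfolding eq q by (simp add: algebra_simps)
    then have q': "t $ j * pconst (v $ k) - t $ k * pconst (v $ j) = lin (y j) * q"
      using yi by simp
    define iv where "iv = pconst (inverse (v $ k))"
    have iv: "pconst (v $ k) * iv = 1"
      using vk by (simp add: iv_def pconst_inverse)
    define w where "w = (t $ k - q * pvar k) * iv"
    have "t $ l = q * pvar l + w * pconst (v $ l)" for l
    proof -
      have "t $ l * pconst (v $ k) - t $ k * pconst (v $ l) = lin (y l) * q"
        using q q' ijk(1) by (cases "l = k") (auto simp: lin_y)
      then have "t $ l * pconst (v $ k) = t $ k * pconst (v $ l) + (pvar l * pconst (v $ k) - pvar k * pconst (v $ l)) * q"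
        unfolding lin_y by (metis diff_add_cancel add.commute)
      then have "t $ l * pconst (v $ k) * iv = (t $ k * pconst (v $ l) + (pvar l * pconst (v $ k) - pvar k * pconst (v $ l)) * q) * iv"
        by simp
      then have "t $ l * (pconst (v $ k) * iv) = q * pvar l * (pconst (v $ k) * iv) + w * pconst (v $ l)"
        by (simp add: w_def algebra_simps)
      then show ?thesis
        by (simp add: iv)
    qed
    then have "t = q *s xvec + w *s cvec v"
      by (simp add: vec_eq_iff xvec_def cvec_def)
    then show ?thesis by blast
  qed
  obtain k where k: "v $ k \<noteq> 0"
    using assms(1) by (auto simp: vec_eq_iff)
  have det: "pvar 1 * (pconst (v $ 2) * t $ 3 - pconst (v $ 3) * t $ 2)
      + pvar 2 * (pconst (v $ 3) * t $ 1 - pconst (v $ 1) * t $ 3)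
      + pvar 3 * (pconst (v $ 1) * t $ 2 - pconst (v $ 2) * t $ 1) = 0" (is "?D = 0")
    using assms(2) by (simp add: vec3_defs xvec_def cvec_def)
  have u: "(UNIV :: 3 set) = {1, 2, 3}" "(UNIV :: 3 set) = {2, 3, 1}" "(UNIV :: 3 set) = {3, 1, 2}"
    using UNIV_3 by auto
  have minor: "(pvar i * pconst (v $ k) - pvar k * pconst (v $ i)) * (t $ j * pconst (v $ k) - t $ k * pconst (v $ j))
        = (pvar j * pconst (v $ k) - pvar k * pconst (v $ j)) * (t $ i * pconst (v $ k) - t $ k * pconst (v $ i))"
    if "(i, j, k) \<in> {(1, 2, 3), (2, 3, 1), (3, 1, 2)}" for i j k
  proof -
    \<comment> \<open>A polynomial identity: up to a sign, which is left open, the difference of the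
      two products of minors is \<open>v $ k\<close> times the full determinant.\<close>
    have "(pvar i * pconst (v $ k) - pvar k * pconst (v $ i)) * (t $ j * pconst (v $ k) - t $ k * pconst (v $ j))
        - (pvar j * pconst (v $ k) - pvar k * pconst (v $ j)) * (t $ i * pconst (v $ k) - t $ k * pconst (v $ i))
      = - pconst (v $ k) * ?D \<or>
      (pvar i * pconst (v $ k) - pvar k * pconst (v $ i)) * (t $ j * pconst (v $ k) - t $ k * pconst (v $ j))
        - (pvar j * pconst (v $ k) - pvar k * pconst (v $ j)) * (t $ i * pconst (v $ k) - t $ k * pconst (v $ i))
      = pconst (v $ k) * ?D"
      using that by (auto simp: algebra_simps)
    then show ?thesis
      unfolding det by simp
  qed
  have "k = 1 \<or> k = 2 \<or> k = 3"
    by (rule exhaust_3)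
  then have "\<exists>q w. t = q *s xvec + w *s cvec v"
  proof (elim disjE)
    \<comment> \<open>The positional arguments of \<open>main\<close> come in the order
      \<open>k\<close>, \<open>i\<close>, \<open>j\<close>, since \<open>k\<close> occurs first in
      its premises; those of \<open>minor\<close> come in the order \<open>i\<close>,
      \<open>j\<close>, \<open>k\<close>.\<close>
    assume "k = 1" then show ?thesis using main[of 1 2 3] minor[of 2 3 1] k u by simp
  next
    assume "k = 2" then show ?thesis using main[of 2 3 1] minor[of 3 1 2] k u by simp
  next
    assume "k = 3" then show ?thesis using main[of 3 1 2] minor[of 1 2 3] k u by simp
  qed
  then show ?thesis
    using that by blast
qed

subsection \<open>Syzygies of an arrangement with a distinguished point\<close>

text \<open>The lines are mere labels, carrying pairwise non-proportional forms. The number of lines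
  through the point is \<open>card G\<close> and that of the others \<open>card H\<close>, the
  quantities \<open>m\<close> and \<open>d - m\<close> of the theorem when the point has maximal
  multiplicity.\<close>

locale pointed_arrangement =
  fixes A :: "'l set" and a :: "'l \<Rightarrow> complex ^ 3" and v :: "complex ^ 3"
  assumes finite_A: "finite A"
    and form_nonzero: "L \<in> A \<Longrightarrow> a L \<noteq> 0"
    and form_not_parallel: "L \<in> A \<Longrightarrow> K \<in> A \<Longrightarrow> L \<noteq> K \<Longrightarrow> a K \<noteq> c *s a L"
    and point_nonzero: "v \<noteq> 0"
    and point_on_line: "\<exists>L\<in>A. dotp (a L) v = 0"
begin

definition G :: "'l set" where "G = {L \<in> A. dotp (a L) v = 0}"
definition H :: "'l set" where "H = {L \<in> A. dotp (a L) v \<noteq> 0}"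
definition f :: polyS where "f = (\<Prod>L\<in>A. lin (a L))"
definition g :: polyS where "g = (\<Prod>L\<in>G. lin (a L))"
definition h :: polyS where "h = (\<Prod>L\<in>H. lin (a L))"

definition dv :: "polyS \<Rightarrow> polyS"
  where "dv p = dotp (cvec v) (grad p)"

definition u :: "polyS ^ 3 \<Rightarrow> polyS"
  where "u t = dotp xvec (crossp (cvec v) t)"

definition D :: "polyS ^ 3"
  where "D = (of_nat (card A) * h) *s cvec v - dv h *s xvec"

lemma finite_G [simp]: "finite G" and finite_H [simp]: "finite H"
  using finite_A by (simp_all add: G_def H_def)

lemma G_Un_H: "A = G \<union> H" "G \<inter> H = {}"
  by (auto simp: G_def H_def)

lemma card_A: "card A = card G + card H"
  using G_Un_H card_Un_disjoint[of G H] by simp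

lemma card_G_pos: "0 < card G"
  using point_on_line by (auto simp: G_def card_gt_0_iff finite_A)

lemma card_A_pos: "0 < card A"
  using card_A card_G_pos by simp

lemma f_eq: "f = g * h"
  unfolding f_def g_def h_def by (subst G_Un_H(1), rule prod.union_disjoint) (use G_Un_H in auto)

lemma prime_form: "L \<in> A \<Longrightarrow> prime_elem (lin (a L))"
  by (simp add: form_nonzero prime_elem_lin)

lemma form_not_dvd: "L \<in> A \<Longrightarrow> K \<in> A \<Longrightarrow> L \<noteq> K \<Longrightarrow> \<not> lin (a L) dvd lin (a K)"
  using form_nonzero form_not_parallel lin_dvd_lin_imp by metis

lemma nonzero_products: "f \<noteq> 0" "g \<noteq> 0" "h \<noteq> 0"
  using form_nonzero by (auto simp: f_def g_def h_def G_def H_def finite_A)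

lemma homogeneous_products: "homogeneous (card A) f" "homogeneous (card G) g" "homogeneous (card H) h"
  unfolding f_def g_def h_def using finite_A by (auto intro!: homogeneous_prod simp del: One_nat_def)

lemma prod_forms_dvd:
  assumes "B \<subseteq> A" "\<And>L. L \<in> B \<Longrightarrow> lin (a L) dvd p"
  shows "(\<Prod>L\<in>B. lin (a L)) dvd p"
proof (rule grouped_prod_prime_dvd[where k = id])
  show "finite B"
    using assms(1) finite_A finite_subset by blast
  show "prime_elem (lin (a L))" if "L \<in> B" for L
    using that assms(1) prime_form by blast
  show "\<not> lin (a L) dvd lin (a K)" if "L \<in> B" "K \<in> B" "id L \<noteq> id K" for L K
    using that assms(1) form_not_dvd[of L K] by auto
  show "(\<Prod>L\<in>{L \<in> B. id L = c}. lin (a L)) dvd p" for c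
  proof -
    have "{L \<in> B. id L = c} = (if c \<in> B then {c} else {})"
      by auto
    then show ?thesis
      using assms(2) by simp
  qed
qed

lemma AR_iff: "t \<in> AR_module f \<longleftrightarrow> dotp t (grad f) = 0"
  by (simp add: AR_module_def dotp_def grad_def)

lemma AR_closed:
  "s \<in> AR_module f \<Longrightarrow> t \<in> AR_module f \<Longrightarrow> s - t \<in> AR_module f"
  "t \<in> AR_module f \<Longrightarrow> p *s t \<in> AR_module f"
  by (simp_all add: AR_iff)

text \<open>Pairing with the homogeneous gradient shifts degrees by a constant, so each component of
  a relation is a relation.\<close>

lemma AR_vhcomp:
  assumes "t \<in> AR_module f"
  shows "vhcomp n t \<in> AR_module f"
proof -
  have "dotp (grad f) (vhcomp n t) = hcomp ((card A - 1) + n) (dotp (grad f) t)"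
    by (rule hcomp_dotp_homogeneous[symmetric])
      (rule homogeneous_triple_grad[OF homogeneous_products(1)])
  also have "dotp (grad f) t = 0"
    using assms by (simp add: AR_iff dotp_commute)
  finally show ?thesis
    by (simp add: AR_iff dotp_commute)
qed

lemma dv_g: "dv g = 0"
proof -
  have "dv g = (\<Sum>L\<in>G. dotp (cvec (a L)) (cvec v) * (\<Prod>K\<in>G - {L}. lin (a K)))"
    unfolding dv_def g_def by (rule dotp_grad_prod_lin) simp
  also have "\<dots> = 0"
    by (simp add: G_def pconst_simps)
  finally show ?thesis .
qed

lemma dv_f: "dv f = g * dv h"
  using dv_g by (simp add: f_eq dv_def)

lemma euler_f: "dotp xvec (grad f) = of_nat (card A) * f"
  unfolding f_def by (rule euler_prod_lin[OF finite_A])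

text \<open>As \<open>g\<close> is constant along \<open>v\<close>, the derivative of
  \<open>f\<close> along \<open>v\<close> is \<open>g * dv h\<close>; by Euler's formula the two
  terms of \<open>D\<close> contribute opposite multiples of
  \<open>f * dv h / h = g * dv h\<close>.\<close>

lemma D_in_AR: "D \<in> AR_module f"
proof -
  have "dotp D (grad f) = of_nat (card A) * h * dv f - dv h * (of_nat (card A) * f)"
    by (simp add: D_def euler_f dv_def)
  then show ?thesis
    unfolding AR_iff dv_f by (simp add: f_eq)
qed

lemma peval_h_point: "peval v h \<noteq> 0"
proof -
  have "(\<Prod>L\<in>H. dotp (a L) v) \<noteq> 0"
    by (subst prod_zero_iff[OF finite_H]) (auto simp: H_def)
  then show ?thesis
    by (simp add: h_def)
qed

text \<open>At the point \<open>v\<close> itself the constant field \<open>v\<close> and the Euler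
  field agree, so Euler's formula for \<open>h\<close> applies.\<close>

lemma peval_dv_h_point: "peval v (dv h) = of_nat (card H) * peval v h"
proof -
  have "peval v (dv h) = peval v (dotp xvec (grad h))"
    by (simp add: dv_def)
  also have "dotp xvec (grad h) = of_nat (card H) * h"
    unfolding h_def by (rule euler_prod_lin) simp
  finally show ?thesis
    by simp
qed

lemma D_nonzero: "D \<noteq> 0"
proof
  assume "D = 0"
  moreover have "veval v D = (of_nat (card G) * peval v h) *s v"
    by (simp add: D_def peval_dv_h_point card_A algebra_simps flip: vector_sub_rdistrib)
  ultimately have "(of_nat (card G) * peval v h) *s v = 0"
    by simp
  then show False
    using point_nonzero peval_h_point card_G_pos by simp
qed

lemma homogeneous_D: "homogeneous_triple (card H) D"
proof -
  \<comment> \<open>The case of no line off the point is separate: the degree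
    \<open>card H - 1\<close> is truncated there, but the derivative of \<open>h = 1\<close>
    vanishes.\<close>
  have "homogeneous (card H) (dv h * pvar i)" for i
  proof (cases "card H = 0")
    case True
    then have "h = 1"
      by (simp add: h_def)
    then show ?thesis
      by (simp add: dv_def)
  next
    case False
    have "homogeneous (0 + (card H - 1) + 1) (dv h * pvar i)"
      unfolding dv_def
      by (intro homogeneous_mult homogeneous_dotp homogeneous_triple_cvec homogeneous_pvar
          homogeneous_triple_grad homogeneous_products(3))
    then show ?thesis
      using False by simp
  qed
  moreover have "homogeneous (card H) (of_nat (card A) * h * pconst (v $ i))" for i
    using homogeneous_mult[OF homogeneous_mult[OF homogeneous_pconst homogeneous_products(3)] homogeneous_pconst,
        of "of_nat (card A)" "v $ i"]
    by (simp add: pconst_simps)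
  ultimately show ?thesis
    by (simp add: homogeneous_triple_def D_def cvec_def xvec_def homogeneous_diff)
qed

section \<open>The determinant \<open>u\<close> on the module of syzygies\<close>

lemma u_simps [simp]:
  "u (s + t) = u s + u t" "u (s - t) = u s - u t" "u (p *s t) = p * u t" "u 0 = 0"
  "u xvec = 0" "u (cvec v) = 0"
  by (simp_all add: u_def)

lemma u_D: "u D = 0"
  by (simp add: D_def)

lemma u_vhcomp: "hcomp (Suc n) (u t) = u (vhcomp n t)"
proof -
  have u_eq: "u s = dotp (crossp xvec (cvec v)) s" for s
    unfolding u_def using dotp_crossp_rotate[of s xvec "cvec v"] by (simp add: dotp_commute)
  have "hcomp (1 + n) (dotp (crossp xvec (cvec v)) t) = dotp (crossp xvec (cvec v)) (vhcomp n t)"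
    using homogeneous_triple_crossp[OF homogeneous_triple_xvec homogeneous_triple_cvec]
    by (intro hcomp_dotp_homogeneous) simp
  then show ?thesis
    by (simp add: u_eq)
qed

text \<open>By the product rule, \<open>lin (a L)\<close> divides the product of the remaining forms
  times the derivative of \<open>lin (a L)\<close> along \<open>t\<close>. It is prime and divides
  none of those forms.\<close>

lemma AR_logarithmic:
  assumes t: "t \<in> AR_module f" and L: "L \<in> A"
  shows "lin (a L) dvd dotp (cvec (a L)) t"
proof -
  define f' where "f' = (\<Prod>K\<in>A - {L}. lin (a K))"
  have f: "f = lin (a L) * f'"
    unfolding f_def f'_def using L finite_A by (simp add: prod.remove)
  have "lin (a L) * dotp t (grad f') + f' * dotp t (cvec (a L)) = 0"
    using t[unfolded AR_iff] by (simp add: f)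
  then have "f' * dotp (cvec (a L)) t = lin (a L) * - dotp t (grad f')"
    by (simp add: dotp_commute eq_neg_iff_add_eq_0 add.commute)
  then have "lin (a L) dvd f' * dotp (cvec (a L)) t"
    by simp
  moreover have "\<not> lin (a L) dvd f'"
    unfolding f'_def using prime_elem_dvd_prod[OF _ prime_form[OF L]] form_not_dvd[OF L] finite_A
    by (metis DiffD1 DiffD2 finite_Diff insertCI)
  ultimately show ?thesis
    using prime_form[OF L] by (simp add: prime_elem_dvd_mult_iff)
qed

text \<open>For a line through the point the \<open>v\<close>-term of Cramer's rule drops out and
  the other two are divisible by its form; comparing a nonzero coordinate of \<open>a L\<close>
  gives divisibility of \<open>u t\<close>.\<close>

lemma g_dvd_u:
  assumes "t \<in> AR_module f"
  shows "g dvd u t"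
  unfolding g_def
proof (rule prod_forms_dvd)
  fix L assume L: "L \<in> G"
  then have LA: "L \<in> A" "dotp (a L) v = 0"
    by (auto simp: G_def)
  obtain i where i: "a L $ i \<noteq> 0"
    using form_nonzero[OF LA(1)] by (auto simp: vec_eq_iff)
  have "u t *s cvec (a L) = lin (a L) *s crossp (cvec v) t + dotp (cvec (a L)) t *s crossp xvec (cvec v)"
    using cramer3[of xvec "cvec v" t "cvec (a L)"] LA(2) by (simp add: u_def lin_eq_dotp pconst_simps)
  then have "u t * pconst (a L $ i)
      = lin (a L) * crossp (cvec v) t $ i + dotp (cvec (a L)) t * crossp xvec (cvec v) $ i"
    by (simp add: vec_eq_iff cvec_def)
  then have "lin (a L) dvd pconst (a L $ i) * u t"
    using AR_logarithmic[OF assms LA(1)] by (simp add: mult.commute)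
  then show "lin (a L) dvd u t"
    using dvd_pconst_mult_iff[OF i] by blast
qed (auto simp: G_def)

text \<open>Write \<open>t\<close> as a combination of \<open>xvec\<close> and \<open>v\<close>.
  Tangency to the lines off the point makes \<open>h\<close> divide the coefficient of
  \<open>v\<close>, and the syzygy equation then determines the coefficient of
  \<open>xvec\<close>.\<close>

lemma u_eq_0_imp_multiple_D:
  assumes t: "t \<in> AR_module f" and "u t = 0"
  obtains s where "t = s *s D"
proof -
  obtain q w where qw: "t = q *s xvec + w *s cvec v"
    using triple_eq_combination[OF point_nonzero] assms(2) unfolding u_def by blast
  have "h dvd w"
    unfolding h_def
  proof (rule prod_forms_dvd)
    fix L assume L: "L \<in> H"
    then have LA: "L \<in> A" "dotp (a L) v \<noteq> 0"
      by (auto simp: H_def)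
    have "dotp (cvec (a L)) t = q * lin (a L) + pconst (dotp (a L) v) * w"
      by (simp add: qw lin_eq_dotp mult.commute)
    moreover have "lin (a L) dvd dotp (cvec (a L)) t"
      by (rule AR_logarithmic[OF t LA(1)])
    ultimately have "lin (a L) dvd pconst (dotp (a L) v) * w"
      by (simp add: dvd_add_right_iff)
    then show "lin (a L) dvd w"
      using dvd_pconst_mult_iff[OF LA(2)] by blast
  qed (auto simp: H_def)
  then obtain w' where w': "w = h * w'" ..
  have "q * (of_nat (card A) * f) + w * dv f = 0"
    using t by (simp add: AR_iff qw euler_f flip: dv_def)
  then have "(g * h) * (of_nat (card A) * q + w' * dv h) = 0"
    unfolding dv_f by (simp add: w' f_eq algebra_simps)
  then have q: "of_nat (card A) * q = - (w' * dv h)"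
    using nonzero_products by (simp add: eq_neg_iff_add_eq_0)
  define n where "n = pconst (inverse (of_nat (card A)))"
  have n: "of_nat (card A) * n = 1"
    using pconst_inverse[of "of_nat (card A)"] card_A_pos by (simp add: n_def pconst_simps)
  have "q = (of_nat (card A) * n) * q"
    by (simp add: n)
  also have "\<dots> = n * (of_nat (card A) * q)"
    by (simp only: mult_ac)
  finally have q': "q = - (n * w' * dv h)"
    by (simp add: q mult.assoc)
  have "w = (of_nat (card A) * n) * (h * w')"
    by (simp add: n w')
  also have "\<dots> = n * w' * (of_nat (card A) * h)"
    by (simp only: mult_ac)
  finally have w: "w = n * w' * (of_nat (card A) * h)" .
  then have "t = (n * w') *s D"
    unfolding qw q' w by (simp add: D_def vec_eq_iff algebra_simps)
  then show ?thesis
    by (rule that)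
qed

lemma degree_ge_card_H:
  assumes "t \<in> AR_module f" "t \<noteq> 0" "homogeneous_triple r t" "u t = 0"
  shows "card H \<le> r"
proof -
  obtain s where s: "t = s *s D"
    using u_eq_0_imp_multiple_D assms by blast
  obtain i where "t $ i \<noteq> 0"
    using assms(2) by (auto simp: vec_eq_iff)
  moreover have "homogeneous r (D $ i * s)" "homogeneous (card H) (D $ i)"
    using assms(3) homogeneous_D by (auto simp: homogeneous_triple_def s mult.commute)
  ultimately show ?thesis
    using homogeneous_quotient(1)[of "card H" "D $ i" r s] by (simp add: s mult.commute)
qed

lemma homogeneous_u:
  assumes "homogeneous_triple r t"
  shows "homogeneous (Suc r) (u t)"
  using homogeneous_dotp[OF homogeneous_triple_xvec homogeneous_triple_crossp[OF homogeneous_triple_cvec assms]]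
  by (simp add: u_def)

lemma card_G_le_degree:
  assumes "t \<in> AR_module f" "homogeneous_triple r t" "u t \<noteq> 0"
  shows "card G \<le> Suc r"
proof -
  obtain s where s: "u t = g * s"
    using g_dvd_u[OF assms(1)] ..
  show ?thesis
    by (rule homogeneous_quotient(1)[of _ g _ s])
      (use s assms(3) homogeneous_products homogeneous_u[OF assms(2)] in auto)
qed

lemma u_eq_const_mult_g:
  assumes "t \<in> AR_module f" "homogeneous_triple r t" "u t \<noteq> 0" "card G = Suc r"
  obtains c where "c \<noteq> 0" "u t = pconst c * g"
proof -
  obtain s where s: "u t = g * s"
    using g_dvd_u[OF assms(1)] ..
  have "homogeneous (Suc r - card G) s"
    by (rule homogeneous_quotient(2)[of _ g])
      (use s assms(3) homogeneous_products homogeneous_u[OF assms(2)] in auto)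
  then obtain c where c: "s = pconst c"
    using assms(4) homogeneous_0_eq_pconst by auto
  have "c \<noteq> 0"
    using assms(3) s c by (auto simp: pconst_simps)
  with s c show ?thesis
    using that by (simp add: mult.commute)
qed

text \<open>Both forms vanish at \<open>y\<close> and at the value of \<open>t\<close> there. If the
  determinant \<open>e\<close> were nonzero, Cramer's rule would make both proportional to the same
  vector; so \<open>u t\<close>, and with it \<open>g\<close>, vanishes at \<open>y\<close>.\<close>

lemma point_on_line_of_u:
  assumes t: "t \<in> AR_module f" and c: "c \<noteq> 0" "u t = pconst c * g"
    and LK: "L \<in> H" "K \<in> H" "L \<noteq> K" and y: "dotp (a L) y = 0" "dotp (a K) y = 0"
  shows "\<exists>M\<in>G. dotp (a M) y = 0"
proof -
  define e where "e = dotp y (crossp v (veval y t))"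
  have par: "e *s a N = dotp (a N) v *s crossp (veval y t) y" if "N \<in> H" "dotp (a N) y = 0" for N
  proof -
    have "lin (a N) dvd dotp (cvec (a N)) t"
      using that AR_logarithmic[OF t] by (simp add: H_def)
    then obtain q where "dotp (cvec (a N)) t = lin (a N) * q" ..
    then have "peval y (dotp (cvec (a N)) t) = peval y (lin (a N) * q)"
      by simp
    then have "dotp (a N) (veval y t) = 0"
      using that(2) by simp
    then show ?thesis
      using cramer3[of y v "veval y t" "a N"] that(2) by (simp add: e_def)
  qed
  have "e = 0"
  proof (rule ccontr)
    assume e: "e \<noteq> 0"
    have nz: "dotp (a L) v \<noteq> 0"
      using LK(1) by (simp add: H_def)
    have "e *s (dotp (a L) v *s a K) = e *s (dotp (a K) v *s a L)"
    proof -
      have "e *s (dotp (a L) v *s a K) = dotp (a L) v *s (e *s a K)"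
        by (simp add: vector_smult_assoc mult.commute)
      also have "\<dots> = dotp (a K) v *s (e *s a L)"
        unfolding par[OF LK(1) y(1)] par[OF LK(2) y(2)] by (simp add: vector_smult_assoc mult.commute)
      finally show ?thesis
        by (simp add: vector_smult_assoc mult.commute)
    qed
    then have "dotp (a L) v *s a K = dotp (a K) v *s a L"
      using e by (simp add: vec_eq_iff)
    then have "a K = (dotp (a K) v / dotp (a L) v) *s a L"
      using nz by (simp add: vec_eq_iff field_simps)
    then show False
      using form_not_parallel LK by (auto simp: H_def)
  qed
  moreover have "peval y (u t) = e"
    by (simp add: u_def e_def)
  ultimately have "peval y g = 0"
    using c by simp
  then show ?thesis
    by (auto simp: g_def)
qed

subsection \<open>A syzygy from a modular point\<close>

text \<open>Normalised to take the value 1 at \<open>v\<close>, so that \<open>b j - b k\<close>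
  vanishes at \<open>v\<close> as well as on the intersection of the lines \<open>j\<close> and
  \<open>k\<close>.\<close>

definition b :: "'l \<Rightarrow> complex ^ 3"
  where "b L = (1 / dotp (a L) v) *s a L"

lemma dotp_b_point: "L \<in> H \<Longrightarrow> dotp (b L) v = 1"
  by (simp add: b_def H_def)

lemma lin_b_dvd_iff: "L \<in> H \<Longrightarrow> lin (b L) dvd p \<longleftrightarrow> lin (a L) dvd p"
proof -
  assume L: "L \<in> H"
  have nz: "dotp (a L) v \<noteq> 0"
    using L by (simp add: H_def)
  then have "pconst (dotp (a L) v) * lin (b L) = lin (a L)" "lin (b L) = pconst (1 / dotp (a L) v) * lin (a L)"
    by (simp_all add: b_def pconst_simps mult.assoc[symmetric] flip: pconst_simps(4))
  then show ?thesis
    by (metis dvd_mult2 dvd_mult_right dvd_triv_right dvd_trans)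
qed

lemma prime_b: "L \<in> H \<Longrightarrow> prime_elem (lin (b L))"
  using dotp_b_point by (fastforce intro: prime_elem_lin)

lemma lin_b_not_dvd:
  assumes "L \<in> H" "K \<in> H" "L \<noteq> K"
  shows "\<not> lin (b L) dvd lin (b K)"
proof
  assume "lin (b L) dvd lin (b K)"
  then obtain c where c: "b K = c *s b L"
    using lin_dvd_lin_imp prime_b[OF assms(1)] by (metis lin_eq_0_iff prime_elem_not_zeroI prime_elem_def)
  then have "c = 1"
    using dotp_b_point[OF assms(1)] dotp_b_point[OF assms(2)] by simp
  with c have "dotp (a K) v *s b K = dotp (a K) v *s b L"
    by simp
  then have "a K = (dotp (a K) v / dotp (a L) v) *s a L"
    using assms by (simp add: b_def H_def vec_eq_iff)
  then show False
    using form_not_parallel assms by (auto simp: H_def)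
qed

lemma prod_lin_b_dvd:
  assumes "J \<subseteq> H" "\<And>j. j \<in> J \<Longrightarrow> lin (b j) dvd p"
  shows "(\<Prod>j\<in>J. lin (b j)) dvd p"
proof (rule grouped_prod_prime_dvd[where k = id])
  show "finite J"
    using assms(1) finite_H finite_subset by blast
  show "prime_elem (lin (b L))" if "L \<in> J" for L
    using that assms(1) prime_b by blast
  show "\<not> lin (b L) dvd lin (b K)" if "L \<in> J" "K \<in> J" "id L \<noteq> id K" for L K
    using that assms(1) lin_b_not_dvd[of L K] by auto
  show "(\<Prod>L\<in>{L \<in> J. id L = c}. lin (b L)) dvd p" for c
  proof -
    have "{L \<in> J. id L = c} = (if c \<in> J then {c} else {})"
      by auto
    then show ?thesis
      using assms(2) by simp
  qed
qed

text \<open>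
  Newton interpolation: for a modular point the required divided differences are polynomials,
  because \<open>b j - b k\<close> is proportional to the form of a line through the point, and on each such
  line the prescribed values \<open>\<tau>\<close> depend linearly on the forms \<open>b j\<close>.
\<close>

lemma newton_interpolation:
  assumes modular: "\<And>j k. j \<in> H \<Longrightarrow> k \<in> H \<Longrightarrow> j \<noteq> k \<Longrightarrow> \<exists>M\<in>G. \<exists>s. b j - b k = s *s a M"
    and t0: "\<And>M. M \<in> G \<Longrightarrow> lin (a M) dvd dotp (cvec (a M)) t0"
    and "J \<subseteq> H"
  shows "\<exists>c. \<forall>j\<in>J. lin (b j) dvd c + dotp (cvec (b j)) t0"
proof -
  have "finite J"
    using assms(3) finite_H finite_subset by blast
  then show ?thesis
    using assms(3)
  proof (induction J rule: finite_induct)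
    case (insert k J)
    \<comment> \<open>\<open>c\<close> has to be congruent to \<open>\<tau> j\<close> modulo
      \<open>lin (b j)\<close> for each node \<open>j\<close>.\<close>
    define \<tau> where "\<tau> j = - dotp (cvec (b j)) t0" for j
    obtain c where c: "\<And>j. j \<in> J \<Longrightarrow> lin (b j) dvd c - \<tau> j"
      using insert by (auto simp: \<tau>_def)
    have JH: "j \<in> H" "j \<noteq> k" if "j \<in> J" for j
      using insert that by auto
    have kH: "k \<in> H"
      using insert by simp
    \<comment> \<open>Reduction modulo the new node along \<open>v\<close>: it sends
      \<open>lin (b j)\<close> to the difference of nodes \<open>lin (b j - b k)\<close> and fixes
      these differences.\<close>
    define \<pi> where "\<pi> = plane_proj (b k) v"
    have \<pi>_lin: "\<pi> (lin (b j)) = lin (b j - b k)" if "j \<in> insert k J" for j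
      using dotp_b_point[of j] that JH(1) kH by (auto simp: \<pi>_def simp del: lin_simps)
    have \<pi>_lin_diff: "\<pi> (lin (b j - b k)) = lin (b j - b k)" if "j \<in> J" for j
      using dotp_b_point[of j] dotp_b_point[OF kH] that JH(1) by (simp add: \<pi>_def del: lin_simps)
    have dvd_iff: "lin (b k) dvd p \<longleftrightarrow> \<pi> p = 0" for p
      unfolding \<pi>_def by (rule lin_dvd_iff[OF dotp_b_point[OF kH]])
    define \<mu> where "\<mu> j = (SOME M. M \<in> G \<and> (\<exists>s. b j - b k = s *s a M))" for j
    have \<mu>: "\<mu> j \<in> G \<and> (\<exists>s. b j - b k = s *s a (\<mu> j))" if "j \<in> J" for j
      unfolding \<mu>_def by (rule someI_ex) (use modular[OF JH(1)[OF that] kH JH(2)[OF that]] in blast)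
    have nz: "b j - b k \<noteq> 0" if "j \<in> J" for j
      using lin_b_not_dvd[OF JH(1)[OF that] kH JH(2)[OF that]] by auto
    define P where "P = (\<Prod>j\<in>J. lin (b j - b k))"
    have "P dvd \<pi> (c - \<tau> k)"
      unfolding P_def
    proof (rule grouped_prod_prime_dvd[where k = \<mu>])
      show "finite J"
        by fact
      show "prime_elem (lin (b j - b k))" if "j \<in> J" for j
        by (rule prime_elem_lin[OF nz[OF that]])
      show "\<not> lin (b i - b k) dvd lin (b j - b k)" if ij: "i \<in> J" "j \<in> J" "\<mu> i \<noteq> \<mu> j" for i j
      proof
        assume dvd: "lin (b i - b k) dvd lin (b j - b k)"
        obtain r where r: "b j - b k = r *s (b i - b k)"
          using lin_dvd_lin_imp[OF nz[OF ij(1)] dvd] .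
        obtain s s' where s: "b i - b k = s *s a (\<mu> i)" "b j - b k = s' *s a (\<mu> j)"
          using \<mu> ij by blast
        have "s' \<noteq> 0"
          using s(2) nz[OF ij(2)] by auto
        have "s' *s a (\<mu> j) = (r * s) *s a (\<mu> i)"
          using r s by (simp add: vector_smult_assoc)
        then have "inverse s' *s (s' *s a (\<mu> j)) = inverse s' *s ((r * s) *s a (\<mu> i))"
          by simp
        then have "a (\<mu> j) = (inverse s' * (r * s)) *s a (\<mu> i)"
          using \<open>s' \<noteq> 0\<close> by (simp add: vector_smult_assoc)
        then show False
          using form_not_parallel[of "\<mu> i" "\<mu> j"] \<mu> ij by (auto simp: G_def)
      qed
      show "(\<Prod>j\<in>{j \<in> J. \<mu> j = M}. lin (b j - b k)) dvd \<pi> (c - \<tau> k)" for M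
      proof (cases "M \<in> G")
        case False
        then have "{j \<in> J. \<mu> j = M} = {}"
          using \<mu> by auto
        then show ?thesis
          by (simp only: prod.empty one_dvd)
      next
        case True
        then obtain q where q: "dotp (cvec (a M)) t0 = lin (a M) * q"
          using t0 by blast
        \<comment> \<open>On one class, \<open>\<tau> k - \<tau> j\<close> is
          \<open>lin (b j - b k)\<close> times the common quotient \<open>q\<close>. Subtracting
          \<open>lin (b k) * q\<close>, which \<open>\<pi>\<close> kills, therefore makes the error
          divisible by every node of the class.\<close>
        have "(\<Prod>j\<in>{j \<in> J. \<mu> j = M}. lin (b j)) dvd c - \<tau> k - lin (b k) * q"
        proof (rule prod_lin_b_dvd)
          fix j assume j: "j \<in> {j \<in> J. \<mu> j = M}"
          then obtain s where s: "b j - b k = s *s a M"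
            using \<mu> by blast
          have "\<tau> k - \<tau> j = dotp (cvec (b j - b k)) t0"
            by (simp add: \<tau>_def)
          also have "\<dots> = lin (b j - b k) * q"
            unfolding s by (simp add: q mult.assoc)
          finally have "c - \<tau> k - lin (b k) * q = (c - \<tau> j) - lin (b j) * q"
            by (simp add: algebra_simps)
          moreover have "lin (b j) dvd (c - \<tau> j) - lin (b j) * q"
            using c j by simp
          ultimately show "lin (b j) dvd c - \<tau> k - lin (b k) * q"
            by (simp only:)
        qed (use JH in auto)
        then obtain z where z: "c - \<tau> k - lin (b k) * q = (\<Prod>j\<in>{j \<in> J. \<mu> j = M}. lin (b j)) * z" ..
        have "\<pi> (c - \<tau> k) = \<pi> (c - \<tau> k - lin (b k) * q)"
          using dvd_iff[of "lin (b k)"] by (simp add: \<pi>_def)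
        also have "\<dots> = (\<Prod>j\<in>{j \<in> J. \<mu> j = M}. \<pi> (lin (b j))) * \<pi> z"
          unfolding z by (simp add: \<pi>_def)
        also have "(\<Prod>j\<in>{j \<in> J. \<mu> j = M}. \<pi> (lin (b j))) = (\<Prod>j\<in>{j \<in> J. \<mu> j = M}. lin (b j - b k))"
          by (rule prod.cong) (auto simp: \<pi>_lin simp del: lin_simps)
        finally show ?thesis
          by simp
      qed
    qed
    then obtain e where e: "\<pi> (c - \<tau> k) = P * e" ..
    \<comment> \<open>Idempotence allows replacing the divided difference \<open>e\<close> by its
      reduction \<open>\<pi> e\<close>, the only part of \<open>e\<close> visible modulo the new
      node.\<close>
    have "\<pi> (\<pi> (c - \<tau> k)) = \<pi> (c - \<tau> k)"
    proof -
      have "\<pi> (\<pi> (c - \<tau> k) - (c - \<tau> k)) = 0"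
        using lin_dvd_plane_proj_diff[of "b k" v "c - \<tau> k"] dvd_iff unfolding \<pi>_def by blast
      then show ?thesis
        by (simp add: \<pi>_def)
    qed
    moreover have "\<pi> P = P"
      using \<pi>_lin_diff unfolding P_def \<pi>_def by (simp del: lin_simps)
    moreover have "\<pi> (P * e) = \<pi> P * \<pi> e"
      by (simp add: \<pi>_def)
    ultimately have X: "\<pi> (c - \<tau> k) = P * \<pi> e"
      using e by metis
    \<comment> \<open>Newton's correction: it vanishes modulo the old nodes and cancels the error at
      the new one.\<close>
    define c' where "c' = c - e * (\<Prod>j\<in>J. lin (b j))"
    have "lin (b j) dvd c' - \<tau> j" if "j \<in> insert k J" for j
    proof (cases "j = k")
      case True
      have "\<pi> (\<Prod>j\<in>J. lin (b j)) = P"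
        using \<pi>_lin unfolding P_def \<pi>_def by (simp del: lin_simps)
      then have "\<pi> (c' - \<tau> k) = \<pi> (c - \<tau> k) - \<pi> e * P"
        by (simp add: c'_def \<pi>_def)
      then show ?thesis
        using True X dvd_iff by simp
    next
      case False
      then have j: "j \<in> J"
        using that by simp
      have "c' - \<tau> j = (c - \<tau> j) - e * (\<Prod>j\<in>J. lin (b j))"
        by (simp add: c'_def)
      moreover have "lin (b j) dvd (\<Prod>j\<in>J. lin (b j))"
        using j insert.hyps by (simp add: prod.remove[of J j])
      ultimately show ?thesis
        using c[OF j] by (simp only: dvd_diff dvd_mult)
    qed
    then have "\<forall>j\<in>insert k J. lin (b j) dvd c' + dotp (cvec (b j)) t0"
      by (simp add: \<tau>_def)
    then show ?case
      by blast
  qed simp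
qed

text \<open>The field \<open>t0\<close> is tangent to the lines through the point, and adding a
  multiple of \<open>v\<close> does not spoil this. Interpolation chooses the multiple so that the
  other lines are preserved too. Subtracting a multiple of the Euler triple then yields a syzygy,
  and leaves \<open>u\<close> unchanged.\<close>

lemma modular_syzygy:
  assumes modular: "\<And>j k. j \<in> H \<Longrightarrow> k \<in> H \<Longrightarrow> j \<noteq> k \<Longrightarrow> \<exists>M\<in>G. \<exists>s. b j - b k = s *s a M"
  shows "\<exists>t\<in>AR_module f. t \<noteq> 0 \<and> homogeneous_triple (card G - 1) t"
proof -
  obtain w where w: "dotp v w = 1"
    using obtain_dual point_nonzero by blast
  define t0 where "t0 = crossp (cvec w) (grad g)"
  have t0_G: "lin (a M) dvd dotp (cvec (a M)) t0" if "M \<in> G" for M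
  proof -
    define g' where "g' = (\<Prod>K\<in>G - {M}. lin (a K))"
    have "g = lin (a M) * g'"
      unfolding g_def g'_def using that by (simp add: prod.remove)
    then have "t0 = lin (a M) *s crossp (cvec w) (grad g') + g' *s crossp (cvec w) (cvec (a M))"
      by (simp add: t0_def del: crossp_cvec_cvec)
    then have "dotp (cvec (a M)) t0 = lin (a M) * dotp (cvec (a M)) (crossp (cvec w) (grad g'))"
      by (simp del: crossp_cvec_cvec)
    then show ?thesis
      by simp
  qed
  obtain c where c: "\<And>j. j \<in> H \<Longrightarrow> lin (b j) dvd c + dotp (cvec (b j)) t0"
    using newton_interpolation[OF modular t0_G, of H] by blast
  define t where "t = t0 + c *s cvec v"
  have log: "lin (a L) dvd dotp (cvec (a L)) t" if "L \<in> A" for L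
  proof (cases "L \<in> G")
    case True
    then show ?thesis
      using t0_G[OF True] by (simp add: t_def G_def pconst_simps)
  next
    case False
    then have L: "L \<in> H"
      using that G_Un_H by auto
    then have nz: "dotp (a L) v \<noteq> 0"
      by (simp add: H_def)
    have "lin (b L) dvd dotp (cvec (b L)) t"
      using c[OF L] dotp_b_point[OF L] by (simp add: t_def pconst_simps add.commute)
    then have "lin (a L) dvd pconst (dotp (a L) v) * dotp (cvec (b L)) t"
      using lin_b_dvd_iff[OF L] by simp
    also have "pconst (dotp (a L) v) * dotp (cvec (b L)) t = dotp (cvec (dotp (a L) v *s b L)) t"
      by simp
    also have "dotp (a L) v *s b L = a L"
      using nz by (simp add: b_def vector_smult_assoc)
    finally show ?thesis .
  qed
  have "f dvd dotp t (grad f)"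
  proof -
    have "dotp t (grad f) = (\<Sum>L\<in>A. dotp (cvec (a L)) t * (\<Prod>K\<in>A - {L}. lin (a K)))"
      unfolding f_def by (rule dotp_grad_prod_lin[OF finite_A])
    moreover have "f dvd dotp (cvec (a L)) t * (\<Prod>K\<in>A - {L}. lin (a K))" if "L \<in> A" for L
    proof -
      have "f = lin (a L) * (\<Prod>K\<in>A - {L}. lin (a K))"
        unfolding f_def using that finite_A by (simp add: prod.remove)
      then show ?thesis
        using log[OF that] by (simp add: mult_dvd_mono)
    qed
    ultimately show ?thesis
      by (simp add: dvd_sum)
  qed
  then obtain \<kappa> where \<kappa>: "dotp t (grad f) = f * \<kappa>" ..
  define n where "n = pconst (inverse (of_nat (card A)))"
  have n: "of_nat (card A) * n = 1"
    using pconst_inverse[of "of_nat (card A)"] card_A_pos by (simp add: n_def pconst_simps)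
  define t' where "t' = t - (n * \<kappa>) *s xvec"
  have "dotp t' (grad f) = f * \<kappa> - (of_nat (card A) * n) * (f * \<kappa>)"
    by (simp add: t'_def \<kappa> euler_f algebra_simps)
  then have t'_AR: "t' \<in> AR_module f"
    by (simp add: AR_iff n)
  have "u t' = u t0"
    by (simp add: t'_def t_def)
  also have "\<dots> = - (of_nat (card G) * g)"
  proof -
    have "u t0 = dv g * dotp xvec (cvec w) - pconst (dotp v w) * dotp xvec (grad g)"
      by (simp add: u_def t0_def crossp_crossp dv_def)
    also have "dotp xvec (grad g) = of_nat (card G) * g"
      unfolding g_def by (rule euler_prod_lin) simp
    finally show ?thesis
      by (simp add: dv_g w pconst_simps)
  qed
  finally have u_t': "u t' = - (of_nat (card G) * g)" .
  have "homogeneous (0 + card G) (pconst (of_nat (card G)) * g)"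
    by (intro homogeneous_mult homogeneous_pconst homogeneous_products)
  then have "hcomp (card G) (u t') = u t'"
    using hcomp_homogeneous[OF homogeneous_uminus] by (simp add: u_t' pconst_simps)
  \<comment> \<open>The interpolating \<open>c\<close> carries no degree bound, so \<open>t'\<close>
    may be inhomogeneous. Its component of degree \<open>card G - 1\<close> is nonzero because
    \<open>u\<close> maps it to a nonzero multiple of \<open>g\<close>.\<close>
  then have "u (vhcomp (card G - 1) t') = u t'"
    using u_vhcomp[of "card G - 1" t'] card_G_pos by simp
  moreover have "u t' \<noteq> 0"
    using card_G_pos nonzero_products(2) by (simp add: u_t' card_gt_0_iff)
  ultimately have "vhcomp (card G - 1) t' \<noteq> 0"
    by auto
  then show ?thesis
    using AR_vhcomp[OF t'_AR] homogeneous_triple_vhcomp by blast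
qed

subsection \<open>Free modules of syzygies\<close>

text \<open>For coordinate vectors \<open>e\<close> these are, up to sign, the trivial relations
  between two partial derivatives of \<open>f\<close>.\<close>

definition koszul :: "complex ^ 3 \<Rightarrow> polyS ^ 3"
  where "koszul e = crossp (cvec e) (grad f)"

lemma koszul_in_AR: "koszul e \<in> AR_module f"
  by (simp add: AR_iff koszul_def dotp_commute)

lemma u_koszul: "u (koszul e) = g * (dv h * lin e - pconst (dotp v e) * (of_nat (card A) * h))"
proof -
  have "u (koszul e) = dv f * dotp xvec (cvec e) - pconst (dotp v e) * dotp xvec (grad f)"
    by (simp add: u_def koszul_def crossp_crossp dv_def)
  also have "\<dots> = g * (dv h * lin e - pconst (dotp v e) * (of_nat (card A) * h))"
    unfolding euler_f dv_f by (simp add: f_eq lin_eq_dotp dotp_commute algebra_simps)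
  finally show ?thesis .
qed

text \<open>
  The cofactor \<open>p\<close> of \<open>g\<close> in a common divisor of all \<open>u (koszul e)\<close> has no zero on a generic line
  through the distinguished point, which by the fundamental theorem of algebra forces it to be constant.
\<close>

lemma common_divisor_no_zero:
  assumes p: "\<And>e. p dvd dv h * lin e - pconst (dotp v e) * (of_nat (card A) * h)"
    and y: "peval y p = 0"
  shows "(\<exists>c. y = c *s v) \<or> (\<exists>L\<in>H. \<exists>K\<in>H. L \<noteq> K \<and> dotp (a L) y = 0 \<and> dotp (a K) y = 0)"
proof -
  have zero: "peval y (dv h) * dotp e y = dotp v e * (of_nat (card A) * peval y h)" for e
  proof -
    obtain q where "dv h * lin e - pconst (dotp v e) * (of_nat (card A) * h) = p * q"
      using p by blast
    then have "peval y (dv h * lin e - pconst (dotp v e) * (of_nat (card A) * h)) = 0"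
      using y by simp
    then show ?thesis
      by simp
  qed
  obtain w where w: "dotp v w = 1"
    using obtain_dual point_nonzero by blast
  show ?thesis
  proof (cases "\<exists>c. y = c *s v")
    case True
    then show ?thesis ..
  next
    case False
    \<comment> \<open>The identity \<open>zero\<close> is linear in \<open>e\<close>: a form
      vanishing at \<open>v\<close> but not at \<open>y\<close> isolates \<open>dv h\<close>, and
      afterwards \<open>w\<close> isolates \<open>h\<close>.\<close>
    then obtain e where e: "dotp e v = 0" "dotp e y \<noteq> 0"
      using obtain_separating_form point_nonzero by metis
    then have dv0: "peval y (dv h) = 0"
      using zero[of e] by (simp add: dotp_commute)
    then have "peval y h = 0"
      using zero[of w] w card_A_pos by simp
    then obtain L where L: "L \<in> H" "dotp (a L) y = 0"
      by (auto simp: h_def)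
    have "dv h = (\<Sum>M\<in>H. dotp (cvec (a M)) (cvec v) * (\<Prod>K\<in>H - {M}. lin (a K)))"
      unfolding dv_def h_def by (rule dotp_grad_prod_lin) simp
    then have "peval y (dv h) = (\<Sum>M\<in>H. dotp (a M) v * (\<Prod>K\<in>H - {M}. dotp (a K) y))"
      by simp
    \<comment> \<open>Since \<open>y\<close> lies on \<open>L\<close>, only the summand omitting the
      factor of \<open>L\<close> can survive; its vanishing yields a second line \<open>K\<close>
      through \<open>y\<close>.\<close>
    also have "\<dots> = (\<Sum>M\<in>H. if M = L then dotp (a L) v * (\<Prod>K\<in>H - {L}. dotp (a K) y) else 0)"
    proof (rule sum.cong)
      fix M assume "M \<in> H"
      show "dotp (a M) v * (\<Prod>K\<in>H - {M}. dotp (a K) y)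
          = (if M = L then dotp (a L) v * (\<Prod>K\<in>H - {L}. dotp (a K) y) else 0)"
      proof (cases "M = L")
        case False
        have "(\<Prod>K\<in>H - {M}. dotp (a K) y) = 0"
          by (rule prod_zero) (use False L in auto)
        with False show ?thesis
          by simp
      qed simp
    qed simp
    also have "\<dots> = dotp (a L) v * (\<Prod>K\<in>H - {L}. dotp (a K) y)"
      using L(1) by simp
    finally have "(\<Prod>K\<in>H - {L}. dotp (a K) y) = 0"
      using dv0 L(1) by (simp add: H_def)
    then obtain K where "K \<in> H - {L}" "dotp (a K) y = 0"
      using prod_zero_iff[of "H - {L}" "\<lambda>K. dotp (a K) y"] by auto
    with L show ?thesis
      by blast
  qed
qed

lemma common_divisor_constant:
  assumes p: "\<And>e. p dvd dv h * lin e - pconst (dotp v e) * (of_nat (card A) * h)"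
    and hom: "homogeneous k p"
  shows "k = 0"
proof (rule ccontr)
  assume k: "k \<noteq> 0"
  \<comment> \<open>At \<open>v\<close> the polynomial divided by \<open>p\<close>, taken for
    \<open>e = w\<close>, has the value \<open>- card G\<close> times the nonzero value of
    \<open>h\<close>.\<close>
  have "peval v p \<noteq> 0"
  proof
    assume v0: "peval v p = 0"
    obtain w where w: "dotp v w = 1"
      using obtain_dual point_nonzero by blast
    obtain q where "dv h * lin w - pconst (dotp v w) * (of_nat (card A) * h) = p * q"
      using p by blast
    then have "peval v (dv h * lin w - pconst (dotp v w) * (of_nat (card A) * h)) = 0"
      using v0 by simp
    then have "of_nat (card H) * peval v h = of_nat (card A) * peval v h"
      using w peval_dv_h_point by (simp add: dotp_commute)
    then show False
      using peval_h_point card_A card_G_pos by simp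
  qed
  \<comment> \<open>\<open>N L K\<close> is a form of the line joining the distinguished point to
    the intersection of \<open>L\<close> and \<open>K\<close>. A point \<open>x0\<close> off all
    these lines and off the lines of \<open>G\<close> keeps every \<open>x0 + t *s v\<close> away
    from the zeros permitted by \<open>common_divisor_no_zero\<close>.\<close>
  define N where "N L K = dotp (a L) v *s a K - dotp (a K) v *s a L" for L K
  define B where "B = a ` G \<union> (\<lambda>(L, K). N L K) ` {(L, K) \<in> H \<times> H. L \<noteq> K}"
  have N_nonzero: "N L K \<noteq> 0" if "L \<in> H" "K \<in> H" "L \<noteq> K" for L K
  proof
    assume "N L K = 0"
    then have "dotp (a L) v *s a K = dotp (a K) v *s a L"
      by (simp add: N_def)
    moreover have "dotp (a L) v \<noteq> 0"
      using that by (simp add: H_def)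
    ultimately have "a K = (dotp (a K) v / dotp (a L) v) *s a L"
      by (simp add: vec_eq_iff field_simps)
    then show False
      using form_not_parallel that by (auto simp: H_def)
  qed
  have "finite {(L, K) \<in> H \<times> H. L \<noteq> K}"
    by (rule finite_subset[of _ "H \<times> H"]) auto
  then have "finite B"
    by (simp add: B_def)
  moreover have "0 \<notin> B"
    using N_nonzero form_nonzero by (force simp: B_def G_def)
  ultimately obtain x0 where x0: "\<And>e. e \<in> B \<Longrightarrow> dotp e x0 \<noteq> 0"
    using obtain_avoiding_point by blast
  have nonzero: "peval (x0 + t *s v) p \<noteq> 0" for t
  proof
    assume "peval (x0 + t *s v) p = 0"
    from common_divisor_no_zero[OF p this] consider c where "x0 + t *s v = c *s v"
      | L K where "L \<in> H" "K \<in> H" "L \<noteq> K" "dotp (a L) (x0 + t *s v) = 0" "dotp (a K) (x0 + t *s v) = 0"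
      by blast
    then show False
    proof cases
      case 1
      obtain L where L: "L \<in> G"
        using card_G_pos by (auto simp: card_gt_0_iff)
      have "dotp (a L) (x0 + t *s v) = dotp (a L) (c *s v)"
        using 1 by simp
      then have "dotp (a L) x0 = 0"
        using L by (simp add: G_def)
      then show False
        using x0 L by (auto simp: B_def)
    next
      case 2
      have "dotp (N L K) (x0 + t *s v) = 0"
        unfolding N_def dotp_simps(3) dotp_simps(9) 2(4,5) by simp
      moreover have "dotp (N L K) v = 0"
        by (simp add: N_def)
      ultimately have "dotp (N L K) x0 = 0"
        by simp
      moreover have "N L K \<in> B"
        using 2 by (auto simp: B_def)
      ultimately show False
        using x0 by blast
    qed
  qed
  define Q where "Q = psub (\<lambda>c. [:c:]) (\<lambda>i. [:x0 $ i, v $ i:]) p"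
  define R where "R = psub (\<lambda>c. [:c:]) (\<lambda>i. [:v $ i, x0 $ i:]) p"
  have Q: "poly Q t = peval (x0 + t *s v) p" for t
    by (simp add: Q_def poly_psub_line)
  have R: "poly R s = peval (v + s *s x0) p" for s
    by (simp add: R_def poly_psub_line)
  have "constant (poly Q)"
    using fundamental_theorem_of_algebra[of Q] nonzero Q by auto
  then have Qc: "poly Q t = poly Q 0" for t
    by (simp add: constant_def)
  \<comment> \<open>\<open>Q\<close> and \<open>R\<close> are \<open>p\<close> in the two affine
    charts of the line through \<open>x0\<close> and \<open>v\<close>. As \<open>Q\<close> is
    constant, homogeneity gives \<open>R = Q(0) s^k\<close> for \<open>s\<close> nonzero; the extra
    factor \<open>s\<close> makes the identity hold at 0 too. For \<open>k > 0\<close> it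
    contradicts the nonvanishing at \<open>v\<close>, where \<open>s = 0\<close>.\<close>
  have "poly (pCons 0 R) s = poly (monom (poly Q 0) (Suc k)) s" for s
  proof (cases "s = 0")
    case False
    then have "v + s *s x0 = s *s (x0 + inverse s *s v)"
      by (simp add: vec_eq_iff algebra_simps)
    then have "poly R s = s ^ k * poly Q (inverse s)"
      unfolding R Q by (simp only: peval_scale[OF hom])
    then show ?thesis
      using Qc[of "inverse s"] by (simp add: poly_monom)
  qed (simp add: poly_monom)
  then have "pCons 0 R = monom (poly Q 0) (Suc k)"
    by (intro poly_ext) auto
  then have "R = monom (poly Q 0) k"
    by (simp add: monom_Suc)
  then have "poly R 0 = 0"
    using k by (simp add: poly_monom)
  then show False
    using R[of 0] \<open>peval v p \<noteq> 0\<close> by simp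
qed

text \<open>The Koszul syzygies serve as test elements: the cofactor \<open>p\<close> of
  \<open>g\<close> in \<open>u t\<close> divides all of theirs, which forces degree 0. It is nonzero
  because these cofactors do not all vanish at \<open>v\<close>.\<close>

lemma generator_u:
  assumes t: "t \<in> AR_module f" "homogeneous_triple r t"
    and gen: "\<And>s. s \<in> AR_module f \<Longrightarrow> u t dvd u s"
  obtains c where "c \<noteq> 0" "u t = pconst c * g"
proof -
  obtain p where p: "u t = g * p"
    using g_dvd_u[OF t(1)] ..
  have dvd: "p dvd dv h * lin e - pconst (dotp v e) * (of_nat (card A) * h)" for e
    using gen[OF koszul_in_AR[of e]] nonzero_products(2) unfolding u_koszul p by simp
  have "p \<noteq> 0"
  proof
    assume "p = 0"
    then have "dv h * lin e = pconst (dotp v e) * (of_nat (card A) * h)" for e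
      using dvd[of e] by simp
    moreover obtain w where w: "dotp v w = 1"
      using obtain_dual point_nonzero by blast
    ultimately have "peval v (dv h * lin w) = peval v (pconst (dotp v w) * (of_nat (card A) * h))"
      by simp
    then have "of_nat (card H) * peval v h = of_nat (card A) * peval v h"
      using w peval_dv_h_point by (simp add: dotp_commute)
    then show False
      using peval_h_point card_A card_G_pos by simp
  qed
  then have "homogeneous (Suc r - card G) p"
    using homogeneous_quotient(2)[of "card G" g "Suc r" p] homogeneous_products(2) nonzero_products(2)
      homogeneous_u[OF t(2)] p by simp
  moreover from this have "Suc r - card G = 0"
    using common_divisor_constant dvd by blast
  ultimately obtain c where "p = pconst c"
    using homogeneous_0_eq_pconst by metis
  then show ?thesis
    using that[of c] p \<open>p \<noteq> 0\<close> by (auto simp: mult.commute)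
qed

text \<open>The minimal-degree syzygy \<open>D\<close> spans the kernel of \<open>u\<close> and
  involves some basis element \<open>b1\<close> with a nonzero constant coefficient, so it can stand
  in for \<open>b1\<close>. Besides \<open>b1\<close> there is at most one basis element, and its
  image under \<open>u\<close> divides all others.\<close>

lemma free_imp_u_generator:
  assumes "graded_free (AR_module f)"
    and min: "\<And>t n. t \<in> AR_module f \<Longrightarrow> t \<noteq> 0 \<Longrightarrow> homogeneous_triple n t \<Longrightarrow> card H \<le> n"
  obtains t n where "t \<in> AR_module f" "homogeneous_triple n t" "\<And>s. s \<in> AR_module f \<Longrightarrow> u t dvd u s"
proof -
  obtain B where B: "\<forall>b\<in>B. \<exists>n. homogeneous_triple n b" and ind: "\<not> polyS_vec.dependent B"
    and span: "polyS_vec.span B = AR_module f"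
    using assms(1) unfolding graded_free_def by blast
  have BAR: "b \<in> AR_module f" if "b \<in> B" for b
    using that polyS_vec.span_base span by blast
  have Bnz: "b \<noteq> 0" if "b \<in> B" for b
    using that ind polyS_vec.dependent_zero by blast
  obtain dg where dg: "\<And>b. b \<in> B \<Longrightarrow> homogeneous_triple (dg b) b"
    using B by metis
  have dg_ge: "card H \<le> dg b" if "b \<in> B" for b
    using min[OF BAR Bnz dg] that by blast
  let ?rep = "polyS_vec.representation B"
  obtain T c where T: "finite T" "T \<subseteq> B" and DT: "D = (\<Sum>b\<in>T. c b *s b)"
    using D_in_AR unfolding span[symmetric] polyS_vec.span_explicit by blast
  \<comment> \<open>In the minimal degree \<open>card H\<close>, basis elements of that degree enter
    with constant coefficients, and those of higher degree do not enter at all.\<close>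
  have "\<exists>e. \<forall>b\<in>T. vhcomp (card H) (c b *s b) = pconst (e b) *s b"
  proof -
    have "\<exists>e. vhcomp (card H) (c b *s b) = pconst e *s b" if "b \<in> T" for b
    proof -
      have b: "b \<in> B"
        using that T by blast
      have comp: "vhcomp (card H) (c b *s b) $ i = hcomp (card H) (b $ i * c b)" for i
        by (simp add: vhcomp_def mult.commute)
      have hb: "homogeneous (dg b) (b $ i)" for i
        using dg[OF b] by (simp add: homogeneous_triple_def)
      show ?thesis
      proof (cases "dg b = card H")
        case True
        obtain e where "hcomp 0 (c b) = pconst e"
          using homogeneous_0_eq_pconst[OF homogeneous_hcomp] by blast
        then have "vhcomp (card H) (c b *s b) = pconst e *s b"
          using hcomp_mult_homogeneous[OF hb, of 0] True by (simp add: vec_eq_iff comp mult.commute)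
        then show ?thesis ..
      next
        case False
        then have "card H < dg b"
          using dg_ge[OF b] by simp
        then have "vhcomp (card H) (c b *s b) = pconst 0 *s b"
          using hcomp_mult_homogeneous_less[OF hb] by (simp add: vec_eq_iff comp pconst_simps)
        then show ?thesis ..
      qed
    qed
    then show ?thesis
      by metis
  qed
  then obtain e where e: "\<And>b. b \<in> T \<Longrightarrow> vhcomp (card H) (c b *s b) = pconst (e b) *s b"
    by blast
  have "D = vhcomp (card H) D"
    using homogeneous_D by (simp add: homogeneous_triple_iff_vhcomp)
  also have "\<dots> = (\<Sum>b\<in>T. vhcomp (card H) (c b *s b))"
    unfolding DT by (simp add: vhcomp_def vec_eq_iff hcomp_sum)
  finally have De: "D = (\<Sum>b\<in>T. pconst (e b) *s b)"
    by (simp add: e)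
  have "\<exists>b1\<in>T. e b1 \<noteq> 0"
  proof (rule ccontr)
    assume "\<not> ?thesis"
    then have "D = 0"
      unfolding De by (intro sum.neutral) (auto simp: pconst_simps)
    then show False
      using D_nonzero by contradiction
  qed
  then obtain b1 where b1: "b1 \<in> T" "e b1 \<noteq> 0"
    by blast
  have b1B: "b1 \<in> B"
    using b1 T by blast
  have rep_base: "?rep b b' = (if b' = b then 1 else 0)" if "b \<in> B" for b b'
    using polyS_vec.representation_basis[OF ind that] by simp
  have "?rep D b1 = (\<Sum>b\<in>T. ?rep (pconst (e b) *s b) b1)"
    unfolding De using polyS_vec.representation_sum[OF ind, of T "\<lambda>b. pconst (e b) *s b"] T
    by (metis (no_types, lifting) polyS_vec.span_base polyS_vec.span_scale subsetD)
  also have "\<dots> = (\<Sum>b\<in>T. if b = b1 then pconst (e b1) else 0)"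
  proof (rule sum.cong)
    fix b assume "b \<in> T"
    then have b: "b \<in> B"
      using T by blast
    then show "?rep (pconst (e b) *s b) b1 = (if b = b1 then pconst (e b1) else 0)"
      using polyS_vec.representation_scale[OF ind polyS_vec.span_base[OF b], of "pconst (e b)"] rep_base[OF b]
      by auto
  qed simp
  also have "\<dots> = pconst (e b1)"
    using b1 T by simp
  finally have rep_D: "?rep D b1 = pconst (e b1)" .
  \<comment> \<open>A kernel element is a multiple of \<open>D\<close>, and the coordinate of
    \<open>D\<close> at \<open>b1\<close> is a nonzero constant; so the coordinate at
    \<open>b1\<close> detects it.\<close>
  have ker_0: "t = 0" if ker: "t \<in> AR_module f" "u t = 0" "?rep t b1 = 0" for t
  proof -
    obtain s where s: "t = s *s D"
      using u_eq_0_imp_multiple_D[OF ker(1,2)] by blast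
    have "?rep t b1 = s * pconst (e b1)"
      unfolding s using polyS_vec.representation_scale[OF ind, of D s] D_in_AR span rep_D by simp
    then show ?thesis
      using ker(3) b1(2) s by simp
  qed
  have u_nz: "u b \<noteq> 0" if "b \<in> B" "b \<noteq> b1" for b
    using ker_0[OF BAR[OF that(1)]] Bnz[OF that(1)] rep_base[OF that(1)] that(2) by auto
  have two: "b = b'" if b: "b \<in> B" "b \<noteq> b1" "b' \<in> B" "b' \<noteq> b1" for b b'
  proof (rule ccontr)
    assume ne: "b \<noteq> b'"
    \<comment> \<open>The obvious relation between the images of \<open>b\<close> and
      \<open>b'\<close>: it lies in the kernel of \<open>u\<close> and has coordinate 0 at
      \<open>b1\<close>, yet a nonzero coordinate at \<open>b\<close>.\<close>
    define z where "z = u b' *s b - u b *s b'"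
    have rep_z: "?rep z x = u b' * ?rep b x - u b * ?rep b' x" for x
    proof -
      have sp: "b \<in> polyS_vec.span B" "b' \<in> polyS_vec.span B"
        using b by (auto intro: polyS_vec.span_base)
      show ?thesis
        unfolding z_def
        by (simp only: polyS_vec.representation_diff[OF ind polyS_vec.span_scale[OF sp(2)] polyS_vec.span_scale[OF sp(1)]]
            polyS_vec.representation_scale[OF ind sp(1)] polyS_vec.representation_scale[OF ind sp(2)])
    qed
    have "z \<in> AR_module f"
      unfolding z_def by (intro AR_closed BAR b)
    moreover have "u z = 0"
      by (simp add: z_def)
    moreover have "?rep z b1 = 0"
      using rep_base[OF b(1)] rep_base[OF b(3)] b(2,4) by (simp add: rep_z)
    ultimately have "z = 0"
      by (rule ker_0)
    then have "?rep z b = 0"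
      by (simp add: polyS_vec.representation_zero)
    then have "u b' = 0"
      using rep_base b ne by (simp add: rep_z)
    then show False
      using u_nz b by blast
  qed
  have gen: "u t dvd u s" if "t \<in> B" "s \<in> AR_module f" and base: "\<And>b. b \<in> B \<Longrightarrow> u t dvd u b" for t s
  proof -
    have "s \<in> polyS_vec.span B"
      using that span by simp
    then obtain S d where "s = (\<Sum>b\<in>S. d b *s b)" "S \<subseteq> B"
      unfolding polyS_vec.span_explicit by blast
    moreover have "u (\<Sum>b\<in>S. d b *s b) = (\<Sum>b\<in>S. d b * u b)"
      by (induction S rule: infinite_finite_induct) auto
    ultimately show ?thesis
      using base by (auto intro!: dvd_sum dvd_mult)
  qed
  have uD: "pconst (e b1) * u b1 + (\<Sum>b\<in>T - {b1}. pconst (e b) * u b) = 0"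
  proof -
    have "u (\<Sum>b\<in>T. pconst (e b) *s b) = (\<Sum>b\<in>T. pconst (e b) * u b)"
      by (induction T rule: infinite_finite_induct) auto
    then show ?thesis
      using u_D De T b1 by (simp add: sum.remove)
  qed
  show ?thesis
  proof (cases "\<exists>b2\<in>B. b2 \<noteq> b1")
    case True
    then obtain b2 where b2: "b2 \<in> B" "b2 \<noteq> b1"
      by blast
    \<comment> \<open>Only \<open>b2\<close> can accompany \<open>b1\<close> in the expansion of
      \<open>D\<close>, so \<open>u D = 0\<close> makes \<open>u b1\<close> a multiple of
      \<open>u b2\<close>.\<close>
    have "u b2 dvd (\<Sum>b\<in>T - {b1}. pconst (e b) * u b)"
    proof (rule dvd_sum)
      fix b assume "b \<in> T - {b1}"
      then have "b = b2"
        using two b2 T by blast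
      then show "u b2 dvd pconst (e b) * u b"
        by simp
    qed
    then have "u b2 dvd pconst (e b1) * u b1"
      using uD[folded eq_neg_iff_add_eq_0] by simp
    then have "u b2 dvd u b1"
      using dvd_pconst_mult_iff[OF b1(2)] by blast
    then have "u b2 dvd u b" if "b \<in> B" for b
      using two[OF b2 that] by (cases "b = b1") auto
    then show ?thesis
      using that[OF BAR[OF b2(1)] dg[OF b2(1)]] gen[OF b2(1)] by blast
  next
    case False
    then have B_eq: "B = {b1}"
      using b1B by blast
    then have "u b1 dvd u b" if "b \<in> B" for b
      using that by simp
    then show ?thesis
      using that[OF BAR[OF b1B] dg[OF b1B]] gen[OF b1B] by blast
  qed
qed

section \<open>Bounds for the minimal degree of a syzygy\<close>

lemma mdr_le:
  assumes "t \<in> AR_module f" "t \<noteq> 0" "homogeneous_triple n t"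
  shows "mdr f \<le> n"
  unfolding mdr_def by (rule Least_le) (use assms in blast)

lemma mdr_le_card_H: "mdr f \<le> card H"
  by (rule mdr_le[OF D_in_AR D_nonzero homogeneous_D])

lemma obtain_minimal_syzygy:
  obtains t where "t \<in> AR_module f" "t \<noteq> 0" "homogeneous_triple (mdr f) t"
proof -
  have "\<exists>\<rho>\<in>AR_module f. \<rho> \<noteq> 0 \<and> homogeneous_triple (mdr f) \<rho>"
    unfolding mdr_def by (rule LeastI) (use D_in_AR D_nonzero homogeneous_D in blast)
  then show ?thesis
    using that by blast
qed

text \<open>For a syzygy of minimal degree, the first alternative comes from a nonzero determinant
  \<open>u\<close>, the second from a zero one.\<close>

lemma mdr_ge: "card G \<le> Suc (mdr f) \<or> card H \<le> mdr f"
  using obtain_minimal_syzygy card_G_le_degree degree_ge_card_H by metis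

text \<open>In the first case a minimal syzygy has too small a degree to be a multiple of
  \<open>D\<close>, and its determinant has exactly the degree of \<open>g\<close>. In the second
  case \<open>D\<close> has minimal degree, so freeness provides a generator of the image of
  \<open>u\<close>.\<close>

lemma obtain_syzygy_u_eq_g:
  assumes "Suc (mdr f) = card G \<and> mdr f < card H \<or> graded_free (AR_module f) \<and> mdr f = card H"
  obtains t c where "t \<in> AR_module f" "c \<noteq> 0" "u t = pconst c * g"
  using assms
proof (elim disjE conjE)
  assume *: "Suc (mdr f) = card G" "mdr f < card H"
  obtain t where t: "t \<in> AR_module f" "t \<noteq> 0" "homogeneous_triple (mdr f) t"
    by (rule obtain_minimal_syzygy)
  then have "u t \<noteq> 0"
    using degree_ge_card_H *(2) by force
  then show thesis
    using u_eq_const_mult_g[OF t(1,3)] *(1) that t(1) by metis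
next
  assume *: "graded_free (AR_module f)" "mdr f = card H"
  obtain t n where t: "t \<in> AR_module f" "homogeneous_triple n t"
    and gen: "\<And>s. s \<in> AR_module f \<Longrightarrow> u t dvd u s"
    using free_imp_u_generator[OF *(1)] mdr_le *(2) by metis
  show thesis
    using generator_u[OF t gen] that t(1) by blast
qed

end

subsection \<open>Points and lines of the projective plane\<close>

lemma proj_points_iff: "p \<in> proj_points \<longleftrightarrow> (\<exists>v. v \<noteq> 0 \<and> p = vec.span {v})"
proof
  assume "p \<in> proj_points"
  then have p: "vec.subspace p" "vec.dim p = 1"
    by (auto simp: proj_points_def)
  obtain B where B: "B \<subseteq> p" "vec.independent B" "p \<subseteq> vec.span B" "card B = 1"
    using vec.basis_exists[of p] p(2) by metis
  then obtain v where v: "B = {v}"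
    by (auto simp: card_1_singleton_iff)
  then have "v \<noteq> 0" "p = vec.span {v}"
    using B p(1) vec.dependent_zero[of B] vec.span_minimal[of B p] by auto
  then show "\<exists>v. v \<noteq> 0 \<and> p = vec.span {v}"
    by blast
next
  assume "\<exists>v. v \<noteq> 0 \<and> p = vec.span {v}"
  then obtain v where v: "v \<noteq> 0" "p = vec.span {v}"
    by blast
  have "vec.independent {v}"
    using v(1) by (simp add: vec.independent_insert)
  then have "vec.dim p = 1"
    using vec.dim_span_eq_card_independent[of "{v}"] v(2) by simp
  then show "p \<in> proj_points"
    using v(2) by (simp add: proj_points_def)
qed

lemma span_eq_line:
  assumes "L \<in> proj_lines" "p \<in> proj_points" "q \<in> proj_points" "p \<noteq> q" "p \<subseteq> L" "q \<subseteq> L"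
  shows "vec.span (p \<union> q) = L"
proof -
  have L: "vec.subspace L" "vec.dim L = 2" and p: "vec.subspace p" "vec.dim p = 1"
    and q: "vec.subspace q" "vec.dim q = 1"
    using assms by (auto simp: proj_lines_def proj_points_def)
  let ?S = "vec.span (p \<union> q)"
  have S: "vec.subspace ?S" "?S \<subseteq> L" "p \<subseteq> ?S" "q \<subseteq> ?S"
    using vec.span_minimal[of "p \<union> q" L] vec.span_superset[of "p \<union> q"] assms(5,6) L(1) by auto
  have "2 \<le> vec.dim ?S"
  proof (rule ccontr)
    assume "\<not> 2 \<le> vec.dim ?S"
    then have "vec.dim ?S \<le> vec.dim p" "vec.dim ?S \<le> vec.dim q"
      using p q by auto
    then have "p = ?S" "q = ?S"
      using vec.subspace_dim_equal p q S by metis+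
    with assms(4) show False
      by simp
  qed
  then show ?thesis
    using vec.subspace_dim_equal[OF S(1) L(1) S(2)] L(2) by simp
qed

locale line_forms =
  fixes A :: "subsp set" and \<alpha> :: "subsp \<Rightarrow> complex ^ 3"
  assumes arrangement: "line_arrangement A"
    and line_eq: "L \<in> A \<Longrightarrow> L = {x. dotp (\<alpha> L) x = 0}"
begin

lemma finite_lines: "finite A" and lines_proj: "A \<subseteq> proj_lines"
  using arrangement by (simp_all add: line_arrangement_def)

lemma mem_line_iff: "L \<in> A \<Longrightarrow> x \<in> L \<longleftrightarrow> dotp (\<alpha> L) x = 0"
  using line_eq by blast

lemma point_subset_line_iff: "L \<in> A \<Longrightarrow> vec.span {v} \<subseteq> L \<longleftrightarrow> dotp (\<alpha> L) v = 0"
proof -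
  assume L: "L \<in> A"
  then have "vec.subspace L"
    using lines_proj by (auto simp: proj_lines_def)
  then have "vec.span {v} \<subseteq> L \<longleftrightarrow> v \<in> L"
    using vec.span_minimal[of "{v}" L] vec.span_base[of v "{v}"] by auto
  then show ?thesis
    using mem_line_iff[OF L] by simp
qed

lemma form_nonzero: "\<alpha> L \<noteq> 0" if "L \<in> A"
proof
  assume "\<alpha> L = 0"
  then have "L = UNIV"
    using line_eq[OF that] by simp
  moreover have "vec.dim L = 2"
    using that lines_proj by (auto simp: proj_lines_def)
  ultimately show False
    using vec_dim_card[where 'a = complex and 'n = 3] by simp
qed

lemma form_not_parallel: "\<alpha> K \<noteq> c *s \<alpha> L" if "L \<in> A" "K \<in> A" "L \<noteq> K"
proof
  assume c: "\<alpha> K = c *s \<alpha> L"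
  then have "c \<noteq> 0"
    using form_nonzero[OF that(2)] by auto
  then have "L = K"
    using line_eq[OF that(1)] line_eq[OF that(2)] c by simp
  with that show False
    by simp
qed

lemma crossp_forms_nonzero: "crossp (\<alpha> L) (\<alpha> K) \<noteq> 0" if "L \<in> A" "K \<in> A" "L \<noteq> K"
  using crossp_eq_0_imp_parallel form_nonzero form_not_parallel that by metis

lemma intersection_point_iff:
  "p \<in> intersection_points A \<longleftrightarrow> (\<exists>v. v \<noteq> 0 \<and> p = vec.span {v} \<and>
    (\<exists>L\<in>A. \<exists>K\<in>A. L \<noteq> K \<and> dotp (\<alpha> L) v = 0 \<and> dotp (\<alpha> K) v = 0))"
proof -
  have "(\<exists>L\<in>A. \<exists>K\<in>A. L \<noteq> K \<and> vec.span {v} \<subseteq> L \<and> vec.span {v} \<subseteq> K) \<longleftrightarrow>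
      (\<exists>L\<in>A. \<exists>K\<in>A. L \<noteq> K \<and> dotp (\<alpha> L) v = 0 \<and> dotp (\<alpha> K) v = 0)" for v
    by (intro bex_cong refl) (simp add: point_subset_line_iff)
  then have eq: "(\<exists>L\<in>A. \<exists>K\<in>A. L \<noteq> K \<and> p \<subseteq> L \<and> p \<subseteq> K) \<longleftrightarrow>
      (\<exists>L\<in>A. \<exists>K\<in>A. L \<noteq> K \<and> dotp (\<alpha> L) v = 0 \<and> dotp (\<alpha> K) v = 0)" if "p = vec.span {v}" for v
    using that by (simp only:)
  show ?thesis
    unfolding intersection_points_def proj_points_iff mem_Collect_eq ex_simps(1)[symmetric] conj_assoc
    by (intro ex_cong1 conj_cong refl eq)
qed

lemma pointed:
  assumes "v \<noteq> 0" "L \<in> A" "dotp (\<alpha> L) v = 0"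
  shows "pointed_arrangement A \<alpha> v"
  by unfold_locales (use assms finite_lines form_nonzero form_not_parallel in auto)

lemma multiplicity_eq:
  "multiplicity_at A (vec.span {v}) = card {L \<in> A. dotp (\<alpha> L) v = 0}"
proof -
  have "{L \<in> A. vec.span {v} \<subseteq> L} = {L \<in> A. dotp (\<alpha> L) v = 0}"
    using point_subset_line_iff by blast
  then show ?thesis
    by (simp add: multiplicity_at_def)
qed

lemma multiplicity_le_max:
  assumes "p \<in> intersection_points A"
  shows "multiplicity_at A p \<le> max_multiplicity A"
proof -
  have "multiplicity_at A q \<le> card A" for q
    unfolding multiplicity_at_def by (rule card_mono) (use finite_lines in auto)
  then have "bdd_above (multiplicity_at A ` intersection_points A)"
    by (auto intro!: bdd_aboveI[of _ "card A"])
  then show ?thesis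
    unfolding max_multiplicity_def using assms by (auto intro: cSUP_upper)
qed

lemma obtain_max_multiplicity_point:
  assumes "intersection_points A \<noteq> {}"
  obtains p where "p \<in> intersection_points A" "multiplicity_at A p = max_multiplicity A"
proof -
  let ?X = "multiplicity_at A ` intersection_points A"
  have "multiplicity_at A q \<le> card A" for q
    unfolding multiplicity_at_def by (rule card_mono) (use finite_lines in auto)
  then have "finite ?X"
    by (intro finite_subset[of ?X "{..card A}"]) auto
  then have "Max ?X \<in> ?X"
    using assms by (intro Max_in) auto
  moreover have "max_multiplicity A = Max ?X"
    using assms by (simp add: max_multiplicity_def Sup_nat_def)
  ultimately show ?thesis
    using that by force
qed

text \<open>If one of two lines through another intersection point also passes through
  \<open>v\<close>, it is the joining line; otherwise the syzygy provides a line of the arrangement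
  through both points.\<close>

lemma modular_point_of_syzygy:
  assumes v: "v \<noteq> 0" "vec.span {v} \<in> intersection_points A"
    and t: "t \<in> AR_module (\<Prod>L\<in>A. lin (\<alpha> L))" "c \<noteq> 0"
      "pointed_arrangement.u v t = pconst c * pointed_arrangement.g A \<alpha> v"
  shows "modular_point A (vec.span {v})"
proof -
  obtain L0 where L0: "L0 \<in> A" "vec.span {v} \<subseteq> L0"
    using v(2) by (auto simp: intersection_points_def)
  then interpret pointed_arrangement A \<alpha> v
    using pointed v(1) point_subset_line_iff by blast
  have "vec.span (vec.span {v} \<union> q) \<in> A" if q: "q \<in> intersection_points A" "q \<noteq> vec.span {v}" for q
  proof -
    obtain y L K where y: "y \<noteq> 0" "q = vec.span {y}" and LK: "L \<in> A" "K \<in> A" "L \<noteq> K"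
      "dotp (\<alpha> L) y = 0" "dotp (\<alpha> K) y = 0"
      using q(1) unfolding intersection_point_iff by blast
    have "\<exists>M\<in>A. dotp (\<alpha> M) v = 0 \<and> dotp (\<alpha> M) y = 0"
    proof (cases "L \<in> H \<and> K \<in> H")
      case True
      then show ?thesis
        using point_on_line_of_u[OF t(1)[folded f_def] t(2,3), of L K y] LK by (auto simp: G_def)
    next
      case False
      then show ?thesis
        using LK by (auto simp: H_def)
    qed
    then obtain M where M: "M \<in> A" "vec.span {v} \<subseteq> M" "q \<subseteq> M"
      using y(2) point_subset_line_iff by blast
    have "vec.span (vec.span {v} \<union> q) = M"
      by (rule span_eq_line)
        (use M v q lines_proj in \<open>auto simp: intersection_points_def\<close>)
    then show ?thesis
      using M(1) by simp
  qed
  then show ?thesis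
    using v(2) by (simp add: modular_point_def)
qed

text \<open>Forms vanishing at \<open>v\<close> and at the intersection \<open>y\<close> of
  \<open>j\<close> and \<open>k\<close> are multiples of \<open>crossp v y\<close>, hence of the
  form of the joining line, which belongs to \<open>A\<close> by modularity. The assumption
  \<open>nz\<close> makes \<open>y\<close> a point different from that of \<open>v\<close>.\<close>

lemma modular_point_forms:
  assumes "modular_point A (vec.span {v})" "v \<noteq> 0"
    and jk: "j \<in> A" "k \<in> A" "j \<noteq> k" and nz: "dotp (\<alpha> j) v \<noteq> 0"
    and e: "dotp e v = 0" "dotp e (crossp (\<alpha> j) (\<alpha> k)) = 0"
  shows "\<exists>M\<in>A. dotp (\<alpha> M) v = 0 \<and> (\<exists>s. e = s *s \<alpha> M)"
proof -
  define y where "y = crossp (\<alpha> j) (\<alpha> k)"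
  have y: "y \<noteq> 0" "dotp (\<alpha> j) y = 0" "dotp (\<alpha> k) y = 0"
    using crossp_forms_nonzero[OF jk] by (simp_all add: y_def)
  have ne: "vec.span {y} \<noteq> vec.span {v}"
    using point_subset_line_iff[OF jk(1)] y(2) nz by blast
  have "vec.span {y} \<in> intersection_points A"
    unfolding intersection_point_iff using y jk by blast
  then have M: "vec.span (vec.span {v} \<union> vec.span {y}) \<in> A"
    using assms(1) ne by (auto simp: modular_point_def)
  define M where "M = vec.span (vec.span {v} \<union> vec.span {y})"
  have MA: "M \<in> A"
    using M by (simp add: M_def)
  have "vec.span {v} \<subseteq> M" "vec.span {y} \<subseteq> M"
    unfolding M_def using vec.span_superset by blast+
  then have Mv: "dotp (\<alpha> M) v = 0" "dotp (\<alpha> M) y = 0"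
    using point_subset_line_iff[OF MA] by auto
  have "crossp (\<alpha> M) (crossp v y) = 0"
    using Mv by (simp add: crossp_crossp)
  then obtain r where r: "crossp v y = r *s \<alpha> M"
    using crossp_eq_0_imp_parallel form_nonzero[OF MA] by blast
  have vy: "crossp v y \<noteq> 0"
  proof
    assume "crossp v y = 0"
    then obtain c where c: "y = c *s v"
      using crossp_eq_0_imp_parallel assms(2) by blast
    then have "c = 0"
      using y(2) nz by simp
    with c y(1) show False
      by simp
  qed
  have "dotp e y = 0"
    using e(2) by (simp add: y_def)
  then have "crossp e (crossp v y) = 0"
    using e(1) by (simp add: crossp_crossp)
  then have "crossp (crossp v y) e = 0"
    using crossp_commute[of "crossp v y" e] by simp
  then obtain s where "e = s *s crossp v y"
    using crossp_eq_0_imp_parallel vy by blast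
  then have "e = (s * r) *s \<alpha> M"
    by (simp add: r vector_smult_assoc)
  then show ?thesis
    using MA Mv(1) by blast
qed

end

theorem proposition2p3:
  fixes A :: "subsp set" and f :: polyS
  assumes "line_arrangement A" and "defining_polynomial A f"
  shows "(graded_free (AR_module f) \<longrightarrow>
      (supersolvable A \<longleftrightarrow>
        int (mdr f) = min (int (max_multiplicity A) - 1) (int (card A) - int (max_multiplicity A))))
    \<and> (max_multiplicity A = mdr f + 1 \<and> real (mdr f + 1) \<le> real (card A) / 2 \<longrightarrow>
      supersolvable A)"
proof (cases "intersection_points A = {}")
  case True
  \<comment> \<open>With maximal multiplicity 0 the integer minimum is negative, so both sides of
    the equivalence fail, and the premise of the second claim fails as well.\<close>
  then have "\<not> supersolvable A" "max_multiplicity A = 0"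
    by (auto simp: supersolvable_def modular_point_def max_multiplicity_def)
  then show ?thesis
    by simp
next
  case False
  obtain \<alpha> where \<alpha>: "\<forall>L\<in>A. L = {x. dotp (\<alpha> L) x = 0}" and f_eq: "f = (\<Prod>L\<in>A. linear_form (\<alpha> L))"
    using assms(2) unfolding defining_polynomial_def dotp_def by blast
  interpret line_forms A \<alpha>
    by unfold_locales (use assms(1) \<alpha> in auto)
  define m where "m = max_multiplicity A"
  obtain p where p: "p \<in> intersection_points A" "multiplicity_at A p = m"
    using obtain_max_multiplicity_point[OF False] unfolding m_def .
  then obtain v L0 where v: "v \<noteq> 0" "p = vec.span {v}" and L0: "L0 \<in> A" "dotp (\<alpha> L0) v = 0"
    unfolding intersection_point_iff by blast
  interpret P: pointed_arrangement A \<alpha> v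
    by (rule pointed[OF v(1) L0])
  have f: "f = P.f"
    by (simp add: f_eq P.f_def)
  have card_G: "card P.G = m"
    using p(2) v(2) multiplicity_eq by (simp add: P.G_def)
  have card_A: "card A = m + card P.H"
    using P.card_A card_G by simp
  have m_pos: "0 < m"
    using P.card_G_pos card_G by simp
  have mdr_le: "mdr f \<le> card P.H"
    using P.mdr_le_card_H f by simp
  have mdr_ge: "m \<le> Suc (mdr f) \<or> card P.H \<le> mdr f"
    using P.mdr_ge f card_G by simp
  have super: "supersolvable A"
    if cond: "Suc (mdr f) = m \<and> mdr f < card P.H \<or> graded_free (AR_module f) \<and> mdr f = card P.H"
  proof -
    obtain t c where "t \<in> AR_module f" "c \<noteq> 0" "P.u t = pconst c * P.g"
      using P.obtain_syzygy_u_eq_g cond unfolding f card_G by blast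
    then have "modular_point A p"
      using modular_point_of_syzygy v p(1) unfolding f_eq by blast
    then show ?thesis
      unfolding supersolvable_def ..
  qed
  \<comment> \<open>The modular point \<open>q\<close> may differ from the point \<open>p\<close> of
    maximal multiplicity. Its multiplicity is at most \<open>m\<close>, so its syzygy still gives
    \<open>mdr f \<le> m - 1\<close>; the bounds at \<open>p\<close> do the rest.\<close>
  have mdr_eq: "int (mdr f) = min (int m - 1) (int (card A) - int m)" if sup: "supersolvable A"
  proof -
    obtain q where q: "modular_point A q"
      using sup unfolding supersolvable_def ..
    then have q_int: "q \<in> intersection_points A"
      by (simp add: modular_point_def)
    then obtain w K0 where w: "w \<noteq> 0" "q = vec.span {w}" and K0: "K0 \<in> A" "dotp (\<alpha> K0) w = 0"
      unfolding intersection_point_iff by blast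
    interpret Q: pointed_arrangement A \<alpha> w
      by (rule pointed[OF w(1) K0])
    have fQ: "f = Q.f"
      by (simp add: f_eq Q.f_def)
    have "card Q.G \<le> m"
      using multiplicity_le_max[OF q_int] w(2) multiplicity_eq by (simp add: Q.G_def m_def)
    moreover have "mdr f \<le> card Q.G - 1"
    proof -
      have "\<exists>M\<in>Q.G. \<exists>s. Q.b j - Q.b k = s *s \<alpha> M" if jk: "j \<in> Q.H" "k \<in> Q.H" "j \<noteq> k" for j k
      proof -
        have "dotp (Q.b j - Q.b k) w = 0"
          using Q.dotp_b_point[OF jk(1)] Q.dotp_b_point[OF jk(2)] by simp
        moreover have "dotp (Q.b j - Q.b k) (crossp (\<alpha> j) (\<alpha> k)) = 0"
          by (simp add: Q.b_def)
        ultimately show ?thesis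
          using modular_point_forms[OF q[unfolded w(2)] w(1), of j k "Q.b j - Q.b k"] jk
          by (auto simp: Q.H_def Q.G_def)
      qed
      then obtain t where "t \<in> AR_module f" "t \<noteq> 0" "homogeneous_triple (card Q.G - 1) t"
        using Q.modular_syzygy unfolding fQ by blast
      then show ?thesis
        using Q.mdr_le unfolding fQ by blast
    qed
    moreover have "0 < card Q.G" "card A = card Q.G + card Q.H"
      "card Q.G \<le> Suc (mdr f) \<or> card Q.H \<le> mdr f"
      using Q.card_G_pos Q.card_A Q.mdr_ge fQ by simp_all
    ultimately show ?thesis
      using mdr_le mdr_ge card_A m_pos by linarith
  qed
  show ?thesis
  proof (intro conjI impI iffI)
    assume free: "graded_free (AR_module f)"
    show "int (mdr f) = min (int (max_multiplicity A) - 1) (int (card A) - int (max_multiplicity A))"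
      if "supersolvable A"
      using mdr_eq[OF that] by (simp add: m_def)
    show "supersolvable A"
      if "int (mdr f) = min (int (max_multiplicity A) - 1) (int (card A) - int (max_multiplicity A))"
    proof (rule super)
      have "int (mdr f) = min (int m - 1) (int (card P.H))"
        using that card_A by (simp add: m_def)
      \<comment> \<open>A tie between \<open>m - 1\<close> and \<open>d - m\<close> falls under the
        second alternative.\<close>
      then show "Suc (mdr f) = m \<and> mdr f < card P.H \<or> graded_free (AR_module f) \<and> mdr f = card P.H"
        using free by linarith
    qed
  next
    assume "max_multiplicity A = mdr f + 1 \<and> real (mdr f + 1) \<le> real (card A) / 2"
    then have "m = Suc (mdr f)" "2 * m \<le> card A"
      by (simp_all add: m_def)
    \<comment> \<open>From \<open>2 * m \<le> d\<close> follows \<open>m - 1 < d - m\<close>, which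
      is the first alternative of \<open>super\<close>.\<close>
    then show "supersolvable A"
      using super card_A by simp
  qed
qed

end
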